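(* Let $\epsilon>0$, $\delta\in(0,\tfrac12)$, and let $\rho,\sigma$ be quantum states on a finite-dimensional Hilbert space $H_A$. Then \[ n^{\star}_{\mathrm B,\epsilon}(\rho,\sigma,0.5,\delta)\ge\frac{(1-2\delta)^2}{e^{-\epsilon}(e^\epsilon-1)^2E_1(\rho\|\sigma)^2}, \qquad n^{\star}_{\mathrm B,\epsilon}(\rho,\sigma,0.5,0.1)\ge\frac{16}{25}\,\frac{1}{e^{-\epsilon}(e^\epsilon-1)^2E_1(\rho\|\sigma)^2}. \]
   Context: All Hilbert spaces are finite-dimensional, $a/0=+\infty$ for $a>0$. $E_\gamma(\rho\|\sigma)=\mathrm{Tr}(\rho-\gamma\sigma)_+$; $E_1(\rho\|\sigma)=\frac12\|\rho-\sigma\|_1$. For $p\in(0,1)$, $p_e(\rho,\sigma,p):=p-pE_{(1-p)/p}(\rho\|\sigma)$ and $n^{\star}_{\mathrm B}(\rho,\sigma,p,\delta):=\inf\{n\in\mathbb N:p_e(\rho^{\otimes n},\sigma^{\otimes n},p)\le\delta\}$. A quantum channel $\mathcal A$ from operators on $H_A$ to operators on some finite-dimensional $H_B$ is in $\mathrm{LDP}_\epsilon$ if $E_{e^\epsilon}(\mathcal A(\rho)\|\mathcal A(\sigma))=0$ for all states $\rho,\sigma$ on $H_A$; $n^{\star}_{\mathrm B,\epsilon}(\rho,\sigma,p,\delta):=\inf_{\mathcal A\in\mathrm{LDP}_\epsilon}n^{\star}_{\mathrm B}(\mathcal A(\rho),\mathcal A(\sigma),p,\delta)$. *)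

theory Defs
  imports "Jordan_Normal_Form.Schur_Decomposition" "Jordan_Normal_Form.Char_Poly"
    "HOL-Computational_Algebra.Fundamental_Theorem_Algebra" "HOL-Library.Extended_Real"
begin

definition mtrace :: "complex mat \<Rightarrow> complex" where
  "mtrace A = (\<Sum>i<dim_row A. A $$ (i, i))"

definition psd :: "nat \<Rightarrow> complex mat \<Rightarrow> bool" where
  "psd d A \<longleftrightarrow> A \<in> carrier_mat d d \<and> mat_adjoint A = A \<and>
     (\<forall>v \<in> carrier_vec d. 0 \<le> Re (\<Sum>i<d. cnj (v $ i) * (A *\<^sub>v v) $ i))"

definition density :: "nat \<Rightarrow> complex mat \<Rightarrow> bool" where
  "density d \<rho> \<longleftrightarrow> psd d \<rho> \<and> mtrace \<rho> = 1"

text \<open>Tr(A)_+ : sum of the positive eigenvalues (with multiplicity) of a Hermitian A.\<close>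
definition trace_pos :: "complex mat \<Rightarrow> real" where
  "trace_pos A = (\<Sum>x\<in>#proots (char_poly A). max 0 (Re x))"

definition E_gamma :: "real \<Rightarrow> complex mat \<Rightarrow> complex mat \<Rightarrow> real" where
  "E_gamma \<gamma> \<rho> \<sigma> = trace_pos (\<rho> - complex_of_real \<gamma> \<cdot>\<^sub>m \<sigma>)"

definition p_err :: "complex mat \<Rightarrow> complex mat \<Rightarrow> real \<Rightarrow> real" where
  "p_err \<rho> \<sigma> p = p - p * E_gamma ((1 - p) / p) \<rho> \<sigma>"

definition tensor_mat :: "complex mat \<Rightarrow> complex mat \<Rightarrow> complex mat" where
  "tensor_mat A B = mat (dim_row A * dim_row B) (dim_col A * dim_col B)
     (\<lambda>(i, j). A $$ (i div dim_row B, j div dim_col B) * B $$ (i mod dim_row B, j mod dim_col B))"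

fun tensor_pow :: "complex mat \<Rightarrow> nat \<Rightarrow> complex mat" where
  "tensor_pow A 0 = 1\<^sub>m 1"
| "tensor_pow A (Suc n) = tensor_mat (tensor_pow A n) A"

definition n_B :: "complex mat \<Rightarrow> complex mat \<Rightarrow> real \<Rightarrow> real \<Rightarrow> ereal" where
  "n_B \<rho> \<sigma> p \<delta> = Inf {ereal (real n) | n. n \<ge> 1 \<and> p_err (tensor_pow \<rho> n) (tensor_pow \<sigma> n) p \<le> \<delta>}"

text \<open>(id_k \<otimes> \<Phi>)(X) for X an operator on C^k \<otimes> C^dA (block matrix with k x k blocks of size dA).\<close>
definition id_tensor_map :: "nat \<Rightarrow> nat \<Rightarrow> nat \<Rightarrow> (complex mat \<Rightarrow> complex mat) \<Rightarrow> complex mat \<Rightarrow> complex mat" where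
  "id_tensor_map k dA dB \<Phi> X = mat (k * dB) (k * dB)
     (\<lambda>(i, j). \<Phi> (mat dA dA (\<lambda>(r, s). X $$ ((i div dB) * dA + r, (j div dB) * dA + s)))
                 $$ (i mod dB, j mod dB))"

definition quantum_channel :: "nat \<Rightarrow> nat \<Rightarrow> (complex mat \<Rightarrow> complex mat) \<Rightarrow> bool" where
  "quantum_channel dA dB \<Phi> \<longleftrightarrow>
     (\<forall>X \<in> carrier_mat dA dA. \<Phi> X \<in> carrier_mat dB dB) \<and>
     (\<forall>X \<in> carrier_mat dA dA. \<forall>Y \<in> carrier_mat dA dA. \<forall>a::complex.
        \<Phi> (a \<cdot>\<^sub>m X + Y) = a \<cdot>\<^sub>m \<Phi> X + \<Phi> Y) \<and>
     (\<forall>X \<in> carrier_mat dA dA. mtrace (\<Phi> X) = mtrace X) \<and>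
     (\<forall>k. \<forall>X. psd (k * dA) X \<longrightarrow> psd (k * dB) (id_tensor_map k dA dB \<Phi> X))"

definition LDP :: "real \<Rightarrow> nat \<Rightarrow> nat \<Rightarrow> (complex mat \<Rightarrow> complex mat) \<Rightarrow> bool" where
  "LDP \<epsilon> dA dB \<Phi> \<longleftrightarrow> quantum_channel dA dB \<Phi> \<and>
     (\<forall>\<rho> \<sigma>. density dA \<rho> \<longrightarrow> density dA \<sigma> \<longrightarrow> E_gamma (exp \<epsilon>) (\<Phi> \<rho>) (\<Phi> \<sigma>) = 0)"

definition n_B_eps :: "real \<Rightarrow> nat \<Rightarrow> complex mat \<Rightarrow> complex mat \<Rightarrow> real \<Rightarrow> real \<Rightarrow> ereal" where
  "n_B_eps \<epsilon> dA \<rho> \<sigma> p \<delta> = (INF (dB, \<Phi>) \<in> {(dB, \<Phi>). LDP \<epsilon> dA dB \<Phi>}. n_B (\<Phi> \<rho>) (\<Phi> \<sigma>) p \<delta>)"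

text \<open>Division with the convention a/0 = +\<infinity> (used only for a > 0).\<close>
definition ediv :: "real \<Rightarrow> real \<Rightarrow> ereal" where
  "ediv a b = (if b = 0 then PInfty else ereal (a / b))"

end

theory Submission
  imports Defs "HOL-Analysis.Convex"
begin

text \<open>Write the two output states as \<open>A A\<^sup>*\<close> and \<open>B B\<^sup>*\<close>. For any such factorizations the trace
  distance of the \<open>n\<close>-fold tensor powers is bounded, via Cauchy--Schwarz and multiplicativity of
  \<open>\<langle>A, B\<rangle>\<close>, by \<open>1 - |\<langle>A, B\<rangle>|\<^sup>2\<^sup>n \<le> n \<parallel>A - B\<parallel>\<^sup>2\<close> (Hilbert--Schmidt norm, phase of \<open>B\<close> chosen
  so that \<open>\<langle>A, B\<rangle> \<ge> 0\<close>), so no relative entropy is needed.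
  Let \<open>\<rho> - \<sigma> = E (\<tau>\<^sub>1 - \<tau>\<^sub>2)\<close> be the Jordan decomposition. Privacy makes all output states
  comparable up to \<open>exp \<epsilon>\<close>; hence \<open>\<omega> = exp (- \<epsilon>) (\<Phi> \<tau>\<^sub>1 + \<Phi> \<tau>\<^sub>2) / 2\<close> lies below both outputs and
  \<open>\<plusminus>(\<Phi> \<rho> - \<Phi> \<sigma>) \<le> 2 E (exp \<epsilon> - 1) \<omega>\<close>. Relative to \<open>\<omega>\<close> both outputs are at least the identity,
  where the square root is \<open>1/2\<close>-Lipschitz, which gives \<open>A\<close> and \<open>B\<close> with
  \<open>\<parallel>A - B\<parallel>\<^sup>2 \<le> (E (exp \<epsilon> - 1))\<^sup>2 tr \<omega> = exp (- \<epsilon>) (exp \<epsilon> - 1)\<^sup>2 E\<^sup>2\<close>.\<close>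

section \<open>Adjoints\<close>

lemma mat_adjoint_dim [simp]:
  "dim_row (mat_adjoint A) = dim_col A" "dim_col (mat_adjoint A) = dim_row A"
  by (auto simp: mat_adjoint_def mat_of_rows_def)

lemma mat_adjoint_index [simp]:
  fixes A :: "complex mat"
  assumes "i < dim_col A" "j < dim_row A"
  shows "mat_adjoint A $$ (i, j) = cnj (A $$ (j, i))"
  using assms by (auto simp: mat_adjoint_def mat_of_rows_def cols_def)

lemma mat_adjoint_carrier [simp]: "A \<in> carrier_mat n m \<Longrightarrow> mat_adjoint A \<in> carrier_mat m n"
  by auto

lemma mat_adjoint_adjoint [simp]: "mat_adjoint (mat_adjoint (A :: complex mat)) = A"
  by (intro eq_matI) auto

lemma mult_mat_entry:
  assumes "A \<in> carrier_mat n m" "B \<in> carrier_mat m k" "i < n" "j < k"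
  shows "(A * B) $$ (i, j) = (\<Sum>l<m. A $$ (i, l) * B $$ (l, j))"
  using assms by (auto simp: scalar_prod_def atLeast0LessThan intro!: sum.cong)

lemma mat_adjoint_mult:
  fixes A :: "complex mat"
  assumes "A \<in> carrier_mat n m" "B \<in> carrier_mat m k"
  shows "mat_adjoint (A * B) = mat_adjoint B * mat_adjoint A"
  by (rule eq_matI) (use assms in \<open>auto simp: scalar_prod_def intro!: sum.cong\<close>)

lemma mat_adjoint_diff:
  fixes A :: "complex mat"
  assumes "A \<in> carrier_mat n m" "B \<in> carrier_mat n m"
  shows "mat_adjoint (A - B) = mat_adjoint A - mat_adjoint B"
  by (rule eq_matI) (use assms in auto)

lemma mat_adjoint_add:
  fixes A :: "complex mat"
  assumes "A \<in> carrier_mat n m" "B \<in> carrier_mat n m"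
  shows "mat_adjoint (A + B) = mat_adjoint A + mat_adjoint B"
  by (rule eq_matI) (use assms in auto)

lemma mat_adjoint_smult:
  fixes A :: "complex mat"
  shows "mat_adjoint (c \<cdot>\<^sub>m A) = cnj c \<cdot>\<^sub>m mat_adjoint A"
  by (rule eq_matI) auto

section \<open>Block-diagonal matrices and congruences\<close>

lemma mat_adjoint_four_block_diag:
  fixes A :: "complex mat"
  assumes "A \<in> carrier_mat m m" "D \<in> carrier_mat n n"
  shows "mat_adjoint (four_block_mat A (0\<^sub>m m n) (0\<^sub>m n m) D)
    = four_block_mat (mat_adjoint A) (0\<^sub>m m n) (0\<^sub>m n m) (mat_adjoint D)"
  by (rule eq_matI) (use assms in auto)

lemma mult_four_block_diag:
  fixes A :: "complex mat"
  assumes "A \<in> carrier_mat m m" "D \<in> carrier_mat n n" "A' \<in> carrier_mat m m" "D' \<in> carrier_mat n n"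
  shows "four_block_mat A (0\<^sub>m m n) (0\<^sub>m n m) D * four_block_mat A' (0\<^sub>m m n) (0\<^sub>m n m) D'
    = four_block_mat (A * A') (0\<^sub>m m n) (0\<^sub>m n m) (D * D')"
proof -
  have "four_block_mat A (0\<^sub>m m n) (0\<^sub>m n m) D * four_block_mat A' (0\<^sub>m m n) (0\<^sub>m n m) D'
    = four_block_mat (A * A' + 0\<^sub>m m n * 0\<^sub>m n m) (A * 0\<^sub>m m n + 0\<^sub>m m n * D')
       (0\<^sub>m n m * A' + D * 0\<^sub>m n m) (0\<^sub>m n m * 0\<^sub>m m n + D * D')"
    by (rule mult_four_block_mat) (use assms in auto)
  also have "\<dots> = four_block_mat (A * A') (0\<^sub>m m n) (0\<^sub>m n m) (D * D')"
    using assms by (intro arg_cong4[where f=four_block_mat]) auto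
  finally show ?thesis .
qed

text \<open>In the spectral theorem this composes the first unitary with the block unitary obtained
  from the induction hypothesis. The choice of the identity for \<open>X\<close> shows that the
  composite is unitary again.\<close>

lemma congruence_by_product:
  fixes X :: "complex mat"
  assumes P: "P \<in> carrier_mat n m" and Q: "Q \<in> carrier_mat m k" and X: "X \<in> carrier_mat n n"
  shows "mat_adjoint (P * Q) * X * (P * Q) = mat_adjoint Q * (mat_adjoint P * X * P) * Q"
proof -
  note P' = mat_adjoint_carrier[OF P] and Q' = mat_adjoint_carrier[OF Q]
  have "mat_adjoint (P * Q) * X * (P * Q) = mat_adjoint Q * (mat_adjoint P * X) * (P * Q)"
    by (simp add: mat_adjoint_mult[OF P Q] assoc_mult_mat[OF Q' P' X])
  also have "\<dots> = mat_adjoint Q * (mat_adjoint P * X) * P * Q"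
    by (rule assoc_mult_mat[symmetric, OF mult_carrier_mat[OF Q' mult_carrier_mat[OF P' X]] P Q])
  also have "mat_adjoint Q * (mat_adjoint P * X) * P = mat_adjoint Q * (mat_adjoint P * X * P)"
    by (rule assoc_mult_mat[OF Q' mult_carrier_mat[OF P' X] P])
  finally show ?thesis .
qed

section \<open>Spectral theorem\<close>

text \<open>The entries are real by construction, so a diagonalization into this form already
  records that the eigenvalues are real.\<close>

definition diag_of :: "nat \<Rightarrow> (nat \<Rightarrow> real) \<Rightarrow> complex mat" where
  "diag_of n l = mat n n (\<lambda>(i, j). if i = j then complex_of_real (l i) else 0)"

lemma diag_of_carrier [simp]: "diag_of n l \<in> carrier_mat n n"
  by (simp add: diag_of_def)

lemma diag_of_dim [simp]: "dim_row (diag_of n l) = n" "dim_col (diag_of n l) = n"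
  by (simp_all add: diag_of_def)

lemma diag_of_index [simp]:
  "i < n \<Longrightarrow> j < n \<Longrightarrow> diag_of n l $$ (i, j) = (if i = j then complex_of_real (l i) else 0)"
  by (simp add: diag_of_def)

lemma mat_adjoint_diag_of [simp]: "mat_adjoint (diag_of n l) = diag_of n l"
  by (rule eq_matI) auto

text \<open>Complete \<open>v\<close> to a basis, orthogonalize with Gram-Schmidt, which keeps the
  first vector, and normalize. Only the direction of the first column matters for an eigenvector, so
  the normalization factor stays an unspecified \<open>c\<close>.\<close>

lemma unitary_first_column:
  fixes v :: "complex vec"
  assumes v: "v \<in> carrier_vec n" "v \<noteq> 0\<^sub>v n"
  obtains W c where "W \<in> carrier_mat n n" "mat_adjoint W * W = 1\<^sub>m n" "col W 0 = c \<cdot>\<^sub>v v"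
proof -
  have n: "n > 0" using v by (cases n) auto
  interpret cof_vec_space n "TYPE(complex)" .
  define b where "b = basis_completion v"
  define ws where "ws = gram_schmidt n b"
  from basis_completion[OF v, folded b_def]
  have b: "span (set b) = carrier_vec n" "distinct b" "\<not> lin_dep (set b)" "set b \<subseteq> carrier_vec n"
    "hd b = v" "length b = n" by auto
  then obtain vs where bv: "b = v # vs" using n by (cases b) auto
  from gram_schmidt_result[OF b(4,2,3) refl, folded ws_def]
  have ws: "set ws \<subseteq> carrier_vec n" "corthogonal ws" "length ws = n"
    using b by auto
  have ws0: "ws ! 0 = v"
    using gram_schmidt_hd[OF v(1), of vs, folded bv ws_def] ws(3) n by (cases ws) auto
  have wsc: "ws ! i \<in> carrier_vec n" if "i < n" for i using ws that by auto
  \<comment> \<open>Gram-Schmidt yields orthogonal but not normalized vectors; \<open>q i\<close> is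
    the squared length to be divided out.\<close>
  define q where "q i = (\<Sum>k<n. (cmod (ws ! i $ k))\<^sup>2)" for i
  have ip: "(\<Sum>k<n. cnj (ws ! i $ k) * ws ! j $ k) = (if i = j then of_real (q i) else 0)"
    and qpos: "q i > 0" if "i < n" "j < n" for i j
  proof -
    have *: "ws ! j \<bullet>c ws ! i = (\<Sum>k<n. cnj (ws ! i $ k) * ws ! j $ k)"
      using wsc[OF that(1)] wsc[OF that(2)]
      by (auto simp: scalar_prod_def atLeast0LessThan intro!: sum.cong)
    show A: "(\<Sum>k<n. cnj (ws ! i $ k) * ws ! j $ k) = (if i = j then of_real (q i) else 0)"
    proof (cases "i = j")
      case True
      show ?thesis unfolding q_def using True
        by (simp add: complex_norm_square mult.commute flip: of_real_power) 
    next
      case False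
      then show ?thesis using corthogonalD[OF ws(2), of j i] that ws(3) * by auto
    qed
    have "ws ! i \<bullet>c ws ! i \<noteq> 0" using corthogonalD[OF ws(2), of i i] that ws(3) by auto
    moreover have "ws ! i \<bullet>c ws ! i = of_real (q i)"
      using wsc[OF that(1)] unfolding q_def
      by (auto simp: scalar_prod_def atLeast0LessThan complex_norm_square simp flip: of_real_power intro!: sum.cong)
    moreover have "q i \<ge> 0" unfolding q_def by (intro sum_nonneg) auto
    ultimately show "q i > 0" by (cases "q i = 0") auto
  qed
  define W where "W = mat n n (\<lambda>(k, i). ws ! i $ k / complex_of_real (sqrt (q i)))"
  have W: "W \<in> carrier_mat n n" by (simp add: W_def)
  have "mat_adjoint W * W = 1\<^sub>m n"
  proof (rule eq_matI)
    fix i j assume ij: "i < dim_row (1\<^sub>m n :: complex mat)" "j < dim_col (1\<^sub>m n :: complex mat)"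
    then have "(mat_adjoint W * W) $$ (i, j) = (\<Sum>k<n. mat_adjoint W $$ (i, k) * W $$ (k, j))"
      using W by (intro mult_mat_entry) auto
    also have "\<dots> = (\<Sum>k<n. cnj (ws ! i $ k) * ws ! j $ k) / (of_real (sqrt (q i)) * of_real (sqrt (q j)))"
      using ij W unfolding sum_divide_distrib by (intro sum.cong) (auto simp: W_def)
    also have "\<dots> = (if i = j then 1 else 0)"
    proof -
      have "complex_of_real (q i) / (of_real (sqrt (q i)) * of_real (sqrt (q i))) = 1"
        using qpos[of i i] ij by (simp flip: of_real_mult)
      then show ?thesis using ip[of i j] ij by auto
    qed
    finally show "(mat_adjoint W * W) $$ (i, j) = 1\<^sub>m n $$ (i, j)" using ij by simp
  qed (use W in auto)
  moreover have "col W 0 = (1 / complex_of_real (sqrt (q 0))) \<cdot>\<^sub>v v"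
    using n v by (auto simp: W_def ws0)
  ultimately show ?thesis using W that by blast
qed

text \<open>Deflation: a unitary whose first column is an eigenvector splits off a block of size
  one, and the induction hypothesis diagonalizes the remaining Hermitian block.\<close>

lemma unitary_diagonalization:
  fixes A :: "complex mat"
  assumes "A \<in> carrier_mat n n" "mat_adjoint A = A"
  shows "\<exists>U l. U \<in> carrier_mat n n \<and> mat_adjoint U * U = 1\<^sub>m n \<and> mat_adjoint U * A * U = diag_of n l"
  using assms
proof (induction n arbitrary: A)
  case 0
  then show ?case by (intro exI[of _ "1\<^sub>m 0"]) (auto intro!: eq_matI)
next
  case (Suc n A)
  note A = Suc.prems(1)
  have "degree (char_poly A) = Suc n" using degree_monic_char_poly[OF A] by simp
  then have "\<not> constant (poly (char_poly A))" by (simp add: constant_degree)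
  then obtain e where "poly (char_poly A) e = 0" using fundamental_theorem_of_algebra by blast
  then have "eigenvalue A e" using eigenvalue_root_char_poly[OF A] by simp
  then obtain v where v: "v \<in> carrier_vec (Suc n)" "v \<noteq> 0\<^sub>v (Suc n)" "A *\<^sub>v v = e \<cdot>\<^sub>v v"
    using A unfolding eigenvalue_def eigenvector_def by auto
  from unitary_first_column[OF v(1,2)] obtain W c
    where W: "W \<in> carrier_mat (Suc n) (Suc n)" "mat_adjoint W * W = 1\<^sub>m (Suc n)" "col W 0 = c \<cdot>\<^sub>v v" .
  define A' where "A' = mat_adjoint W * A * W"
  have A': "A' \<in> carrier_mat (Suc n) (Suc n)" using A W by (auto simp: A'_def)
  have hA': "mat_adjoint A' = A'"
  proof -
    have "mat_adjoint A' = mat_adjoint W * mat_adjoint (mat_adjoint W * A)"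
      unfolding A'_def by (rule mat_adjoint_mult) (use A W in auto)
    also have "mat_adjoint (mat_adjoint W * A) = A * W"
      using mat_adjoint_mult[of "mat_adjoint W" "Suc n" "Suc n" A "Suc n"] A W Suc.prems(2) by simp
    also have "mat_adjoint W * (A * W) = A'"
      unfolding A'_def by (rule assoc_mult_mat[symmetric]) (use A W in auto)
    finally show ?thesis .
  qed
  have herm: "A' $$ (i, j) = cnj (A' $$ (j, i))" if "i < Suc n" "j < Suc n" for i j
    using that A' mat_adjoint_index[of i A' j] hA' by simp
  \<comment> \<open>The first column of \<open>W\<close> is an eigenvector, so \<open>A'\<close>
    sends the first unit vector to \<open>e\<close> times itself.\<close>
  have col0: "A' $$ (i, 0) = (if i = 0 then e else 0)" if "i < Suc n" for i
  proof -
    have "col A' 0 = (mat_adjoint W * A) *\<^sub>v col W 0"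
      unfolding A'_def by (rule col_mult2) (use A W in auto)
    also have "\<dots> = mat_adjoint W *\<^sub>v (A *\<^sub>v col W 0)"
      by (rule assoc_mult_mat_vec) (use A W v in auto)
    also have "A *\<^sub>v col W 0 = e \<cdot>\<^sub>v col W 0"
      unfolding W(3) using v A by (subst mult_mat_vec[of A "Suc n" "Suc n"]) (auto simp: smult_smult_assoc mult.commute)
    also have "mat_adjoint W *\<^sub>v (e \<cdot>\<^sub>v col W 0) = e \<cdot>\<^sub>v (mat_adjoint W *\<^sub>v col W 0)"
      by (rule mult_mat_vec) (use W v in auto)
    also have "mat_adjoint W *\<^sub>v col W 0 = col (mat_adjoint W * W) 0"
      by (rule col_mult2[symmetric]) (use W in auto)
    finally have "col A' 0 = e \<cdot>\<^sub>v col (1\<^sub>m (Suc n)) 0" using W by simp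
    then have "col A' 0 $ i = (e \<cdot>\<^sub>v col (1\<^sub>m (Suc n)) 0) $ i" by simp
    then show ?thesis using that A' by (auto split: if_splits)
  qed
  \<comment> \<open>A diagonal entry of a Hermitian matrix is real.\<close>
  have e: "e = complex_of_real (Re e)"
    using herm[of 0 0] col0[of 0] by (metis Reals_cnj_iff of_real_Re zero_less_Suc)
  \<comment> \<open>Hermitian symmetry carries the zeros of the first column over to the first row,
    which makes \<open>A'\<close> block diagonal.\<close>
  have row0: "A' $$ (0, i) = (if i = 0 then e else 0)" if "i < Suc n" for i
    using herm[of 0 i] col0[OF that] col0[of 0] that by auto
  define B where "B = mat n n (\<lambda>(i, j). A' $$ (Suc i, Suc j))"
  have B: "B \<in> carrier_mat n n" by (simp add: B_def)
  have "mat_adjoint B = B"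
  proof (rule eq_matI)
    show "mat_adjoint B $$ (i, j) = B $$ (i, j)" if "i < dim_row B" "j < dim_col B" for i j
      using that herm[of "Suc i" "Suc j"] by (auto simp: B_def)
  qed (use B in auto)
  from Suc.IH[OF B this] obtain V l
    where V: "V \<in> carrier_mat n n" "mat_adjoint V * V = 1\<^sub>m n" "mat_adjoint V * B * V = diag_of n l"
    by blast
  let ?D = "\<lambda>x Y. four_block_mat x (0\<^sub>m 1 n) (0\<^sub>m n 1) (Y :: complex mat)"
  define E where "E = mat 1 1 (\<lambda>_. e)"
  have A'block: "A' = ?D E B"
    by (rule eq_matI) (use A' B in \<open>auto simp: B_def E_def col0 row0\<close>)
  let ?V = "?D (1\<^sub>m 1) V"
  have adjV: "mat_adjoint ?V = ?D (1\<^sub>m 1) (mat_adjoint V)"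
    by (subst mat_adjoint_four_block_diag) (use V in \<open>auto intro!: arg_cong4[where f=four_block_mat] eq_matI\<close>)
  have V': "?V \<in> carrier_mat (Suc n) (Suc n)"
    using four_block_carrier_mat[of "1\<^sub>m 1" 1 1 V n n "0\<^sub>m 1 n" "0\<^sub>m n 1"] V by auto
  have VV: "mat_adjoint ?V * ?V = 1\<^sub>m (Suc n)"
    unfolding adjV using V 
    by (subst mult_four_block_diag) (auto intro!: eq_matI)
  have diag: "mat_adjoint ?V * A' * ?V = diag_of (Suc n) (case_nat (Re e) l)"
  proof -
    have E: "E \<in> carrier_mat 1 1" by (simp add: E_def)
    have "mat_adjoint ?V * A' * ?V = ?D (1\<^sub>m 1 * E) (mat_adjoint V * B) * ?V"
      unfolding adjV A'block by (subst mult_four_block_diag) (use V B E in auto)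
    also have "\<dots> = ?D (1\<^sub>m 1 * E * 1\<^sub>m 1) (mat_adjoint V * B * V)"
      by (subst mult_four_block_diag) (use V B E in \<open>auto intro!: mult_carrier_mat[of _ n n]\<close>)
    also have "\<dots> = ?D E (diag_of n l)" using E V by simp
    also have "E = diag_of 1 (\<lambda>_. Re e)"
      by (rule eq_matI) (auto simp: E_def e[symmetric])
    also have "?D (diag_of 1 (\<lambda>_. Re e)) (diag_of n l) = diag_of (Suc n) (case_nat (Re e) l)"
      by (rule eq_matI) (auto simp: diag_of_def split: nat.splits)
    finally show ?thesis .
  qed
  define U where "U = W * ?V"
  have U: "U \<in> carrier_mat (Suc n) (Suc n)" unfolding U_def by (rule mult_carrier_mat[OF W(1) V'])
  note cong = congruence_by_product[OF W(1) V', folded U_def]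
  have "mat_adjoint U * U = 1\<^sub>m (Suc n)"
    using cong[OF one_carrier_mat] VV
    unfolding right_mult_one_mat[OF mat_adjoint_carrier[OF U]]
      right_mult_one_mat[OF mat_adjoint_carrier[OF W(1)]] W(2)
      right_mult_one_mat[OF mat_adjoint_carrier[OF V']] by simp
  moreover have "mat_adjoint U * A * U = diag_of (Suc n) (case_nat (Re e) l)"
    using cong[OF A] diag by (simp add: A'_def)
  ultimately show ?case using U by blast
qed

text \<open>For a square matrix the left inverse \<open>mat_adjoint U\<close> is also a right
  inverse, so the diagonalization can be solved for \<open>A\<close>.\<close>

lemma unitary_decomposition:
  fixes A :: "complex mat"
  assumes A: "A \<in> carrier_mat n n" "mat_adjoint A = A"
  obtains U l where "U \<in> carrier_mat n n" "mat_adjoint U * U = 1\<^sub>m n" "U * mat_adjoint U = 1\<^sub>m n"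
    "mat_adjoint U * A * U = diag_of n l" "A = U * diag_of n l * mat_adjoint U"
proof -
  obtain U l where U: "U \<in> carrier_mat n n" "mat_adjoint U * U = 1\<^sub>m n"
    and l: "mat_adjoint U * A * U = diag_of n l"
    using unitary_diagonalization[OF A] by blast
  note U' = mat_adjoint_carrier[OF U(1)]
  have UU: "U * mat_adjoint U = 1\<^sub>m n" by (rule mat_mult_left_right_inverse[OF U' U(1,2)])
  have "U * (mat_adjoint U * A * U) * mat_adjoint U = (U * mat_adjoint U) * A * (U * mat_adjoint U)"
    using U(1) U' A
    by (simp add: assoc_mult_mat[of _ n n _ n _ n] mult_carrier_mat[of _ n n _ n])
  then have "A = U * diag_of n l * mat_adjoint U" using A UU l by simp
  with that U UU l show ?thesis by blast
qed

section \<open>Traces and the Hilbert-Schmidt norm\<close>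

lemma mtrace_mult_commute:
  assumes "A \<in> carrier_mat n m" "B \<in> carrier_mat m n"
  shows "mtrace (A * B) = mtrace (B * A)"
proof -
  have "mtrace (A * B) = (\<Sum>i<n. \<Sum>l<m. A $$ (i, l) * B $$ (l, i))"
    using assms by (auto simp: mtrace_def mult_mat_entry[OF assms] intro!: sum.cong simp del: index_mult_mat(1))
  also have "\<dots> = (\<Sum>l<m. \<Sum>i<n. B $$ (l, i) * A $$ (i, l))"
    by (subst sum.swap) (simp add: mult.commute)
  also have "\<dots> = mtrace (B * A)"
    using assms by (auto simp: mtrace_def mult_mat_entry[OF assms(2,1)] intro!: sum.cong simp del: index_mult_mat(1))
  finally show ?thesis .
qed

definition hs_sq :: "complex mat \<Rightarrow> real" where
  "hs_sq A = (\<Sum>i<dim_row A. \<Sum>j<dim_col A. (cmod (A $$ (i, j)))\<^sup>2)"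

text \<open>For matrices of equal shape this is the trace of \<open>A * mat_adjoint B\<close>,
  antilinear in the second argument.\<close>

definition hs_inner :: "complex mat \<Rightarrow> complex mat \<Rightarrow> complex" where
  "hs_inner A B = (\<Sum>i<dim_row A. \<Sum>j<dim_col A. A $$ (i, j) * cnj (B $$ (i, j)))"

lemma mult_adjoint_diag_entry:
  assumes "A \<in> carrier_mat n m" "i < n"
  shows "(A * mat_adjoint A) $$ (i, i) = complex_of_real (\<Sum>k<m. (cmod (A $$ (i, k)))\<^sup>2)"
proof -
  have "(A * mat_adjoint A) $$ (i, i) = (\<Sum>k<m. A $$ (i, k) * mat_adjoint A $$ (k, i))"
    by (rule mult_mat_entry) (use assms in auto)
  also have "\<dots> = (\<Sum>k<m. complex_of_real ((cmod (A $$ (i, k)))\<^sup>2))"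
    using assms by (intro sum.cong) (auto simp: complex_norm_square simp del: of_real_power)
  finally show ?thesis by simp
qed

lemma mtrace_mult_adjoint: "mtrace (A * mat_adjoint A) = complex_of_real (hs_sq A)"
proof -
  have "mtrace (A * mat_adjoint A) = (\<Sum>i<dim_row A. complex_of_real (\<Sum>k<dim_col A. (cmod (A $$ (i, k)))\<^sup>2))"
    unfolding mtrace_def by (intro sum.cong mult_adjoint_diag_entry) auto
  then show ?thesis by (simp add: hs_sq_def)
qed

lemma hs_sq_adjoint: "hs_sq (mat_adjoint A) = hs_sq A"
  unfolding hs_sq_def by (subst sum.swap) simp

lemma mtrace_adjoint_mult: "mtrace (mat_adjoint A * A) = complex_of_real (hs_sq A)"
  using mtrace_mult_adjoint[of "mat_adjoint A"] by (simp add: hs_sq_adjoint)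

text \<open>\<open>hs_sq\<close> is the trace of \<open>mat_adjoint A * A\<close>, in which the
  unitary factors cancel.\<close>

lemma hs_sq_unitary_left:
  assumes U: "U \<in> carrier_mat n n" "mat_adjoint U * U = 1\<^sub>m n" and A: "A \<in> carrier_mat n m"
  shows "hs_sq (U * A) = hs_sq A"
proof -
  have "mat_adjoint (U * A) * (U * A) = mat_adjoint A * A"
  proof -
    have "mat_adjoint (U * A) * (U * A) = mat_adjoint (U * A) * 1\<^sub>m n * (U * A)"
      by (subst right_mult_one_mat[of _ m n]) (use U A in auto)
    also have "\<dots> = mat_adjoint A * (mat_adjoint U * 1\<^sub>m n * U) * A"
      by (rule congruence_by_product[OF U(1) A one_carrier_mat])
    also have "mat_adjoint U * 1\<^sub>m n * U = 1\<^sub>m n"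
      by (simp add: right_mult_one_mat[OF mat_adjoint_carrier[OF U(1)]] U(2))
    also have "mat_adjoint A * 1\<^sub>m n * A = mat_adjoint A * A"
      by (simp add: right_mult_one_mat[OF mat_adjoint_carrier[OF A]])
    finally show ?thesis .
  qed
  then have "complex_of_real (hs_sq (U * A)) = complex_of_real (hs_sq A)"
    by (simp only: mtrace_adjoint_mult[symmetric])
  then show ?thesis by simp
qed

lemma hs_sq_unitary_right:
  assumes U: "U \<in> carrier_mat n n" "U * mat_adjoint U = 1\<^sub>m n" and A: "A \<in> carrier_mat m n"
  shows "hs_sq (A * U) = hs_sq A"
proof -
  have "hs_sq (A * U) = hs_sq (mat_adjoint U * mat_adjoint A)"
    by (simp add: mat_adjoint_mult[OF A U(1), symmetric] hs_sq_adjoint)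
  also have "\<dots> = hs_sq A"
    by (subst hs_sq_unitary_left[of _ n _ m]) (use U A in \<open>auto simp: hs_sq_adjoint\<close>)
  finally show ?thesis .
qed

lemma hs_sq_add_diff:
  assumes "A \<in> carrier_mat n m" "B \<in> carrier_mat n m"
  shows "hs_sq (A - B) = hs_sq A + hs_sq B - 2 * Re (hs_inner A B)"
    and "hs_sq (A + B) = hs_sq A + hs_sq B + 2 * Re (hs_inner A B)"
proof -
  have *: "(cmod (x - y))\<^sup>2 = (cmod x)\<^sup>2 + (cmod y)\<^sup>2 - 2 * Re (x * cnj y)"
    "(cmod (x + y))\<^sup>2 = (cmod x)\<^sup>2 + (cmod y)\<^sup>2 + 2 * Re (x * cnj y)" for x y
    unfolding cmod_power2 by (simp_all add: power2_eq_square algebra_simps)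
  show "hs_sq (A - B) = hs_sq A + hs_sq B - 2 * Re (hs_inner A B)"
    using assms by (simp add: hs_sq_def hs_inner_def * sum.distrib sum_subtractf sum_distrib_left)
  show "hs_sq (A + B) = hs_sq A + hs_sq B + 2 * Re (hs_inner A B)"
    using assms by (simp add: hs_sq_def hs_inner_def * sum.distrib sum_distrib_left)
qed

section \<open>Quadratic forms\<close>

text \<open>The antilinear argument comes first, opposite to \<open>hs_inner\<close>.\<close>

definition cip :: "complex vec \<Rightarrow> complex vec \<Rightarrow> complex" where
  "cip u w = (\<Sum>i<dim_vec w. cnj (u $ i) * w $ i)"

text \<open>Operator inequalities are expressed pointwise through these forms. The real part makes
  the form real-valued for every matrix.\<close>

definition qform :: "complex mat \<Rightarrow> complex vec \<Rightarrow> real" where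
  "qform A v = Re (cip v (A *\<^sub>v v))"

definition vsq :: "complex vec \<Rightarrow> real" where
  "vsq v = (\<Sum>i<dim_vec v. (cmod (v $ i))\<^sup>2)"

lemma cip_adjoint:
  assumes "M \<in> carrier_mat n m" "u \<in> carrier_vec m" "w \<in> carrier_vec n"
  shows "cip (M *\<^sub>v u) w = cip u (mat_adjoint M *\<^sub>v w)"
proof -
  have "cip (M *\<^sub>v u) w = (\<Sum>i<n. \<Sum>j<m. cnj (M $$ (i, j)) * cnj (u $ j) * w $ i)"
    using assms by (auto simp: cip_def scalar_prod_def atLeast0LessThan sum_distrib_right intro!: sum.cong)
  also have "\<dots> = (\<Sum>j<m. \<Sum>i<n. cnj (u $ j) * (cnj (M $$ (i, j)) * w $ i))"
    by (subst sum.swap) (simp add: mult_ac)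
  also have "\<dots> = cip u (mat_adjoint M *\<^sub>v w)"
    using assms by (auto simp: cip_def scalar_prod_def atLeast0LessThan sum_distrib_left intro!: sum.cong)
  finally show ?thesis .
qed

lemma qform_congruence:
  assumes M: "M \<in> carrier_mat n m" and A: "A \<in> carrier_mat n n" and v: "v \<in> carrier_vec m"
  shows "qform (mat_adjoint M * A * M) v = qform A (M *\<^sub>v v)"
proof -
  have "mat_adjoint M * A * M *\<^sub>v v = mat_adjoint M *\<^sub>v (A *\<^sub>v (M *\<^sub>v v))"
    using assms by (simp add: assoc_mult_mat_vec[of _ m n] assoc_mult_mat_vec[of _ m n _ m] mult_carrier_mat[of _ m n])
  then show ?thesis
    unfolding qform_def using cip_adjoint[OF M v, of "A *\<^sub>v (M *\<^sub>v v)"] assms by simp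
qed

lemma cip_add_right: "dim_vec w = dim_vec w' \<Longrightarrow> cip u (w + w') = cip u w + cip u w'"
  by (auto simp: cip_def algebra_simps sum.distrib)

lemma cip_diff_right: "dim_vec w = dim_vec w' \<Longrightarrow> cip u (w - w') = cip u w - cip u w'"
  by (auto simp: cip_def algebra_simps sum_subtractf)

lemma cip_smult_right: "cip u (c \<cdot>\<^sub>v w) = c * cip u w"
  by (auto simp: cip_def sum_distrib_left mult_ac)

lemma cip_smult_left: "dim_vec u = dim_vec w \<Longrightarrow> cip (c \<cdot>\<^sub>v u) w = cnj c * cip u w"
  by (auto simp: cip_def sum_distrib_left mult_ac)

lemma qform_add:
  assumes "A \<in> carrier_mat n n" "B \<in> carrier_mat n n" "v \<in> carrier_vec n"
  shows "qform (A + B) v = qform A v + qform B v"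
  using assms by (simp add: qform_def add_mult_distrib_mat_vec[of _ n n] cip_add_right)

lemma qform_diff:
  assumes "A \<in> carrier_mat n n" "B \<in> carrier_mat n n" "v \<in> carrier_vec n"
  shows "qform (A - B) v = qform A v - qform B v"
  using assms by (simp add: qform_def minus_mult_distrib_mat_vec[of _ n n] cip_diff_right)

lemma qform_smult:
  assumes "A \<in> carrier_mat n n" "v \<in> carrier_vec n"
  shows "qform (complex_of_real c \<cdot>\<^sub>m A) v = c * qform A v"
proof -
  have "complex_of_real c \<cdot>\<^sub>m A *\<^sub>v v = complex_of_real c \<cdot>\<^sub>v (A *\<^sub>v v)"
    using assms by (intro eq_vecI) auto
  then show ?thesis by (simp add: qform_def cip_smult_right)
qed

lemma qform_diag_of:
  assumes "v \<in> carrier_vec n"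
  shows "qform (diag_of n l) v = (\<Sum>i<n. l i * (cmod (v $ i))\<^sup>2)"
proof -
  have "(diag_of n l *\<^sub>v v) $ i = complex_of_real (l i) * v $ i" if "i < n" for i
  proof -
    have "(diag_of n l *\<^sub>v v) $ i = (\<Sum>j<n. diag_of n l $$ (i, j) * v $ j)"
      using assms that by (auto simp: scalar_prod_def atLeast0LessThan)
    also have "\<dots> = (\<Sum>j<n. if j = i then complex_of_real (l i) * v $ i else 0)"
      using that by (intro sum.cong) auto
    finally have "(diag_of n l *\<^sub>v v) $ i = (\<Sum>j<n. if j = i then complex_of_real (l i) * v $ i else 0)" .
    then show ?thesis using that by simp
  qed
  then have "cip v (diag_of n l *\<^sub>v v) = (\<Sum>i<n. complex_of_real (l i * (cmod (v $ i))\<^sup>2))"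
    using assms by (auto simp: cip_def complex_norm_square mult_ac intro!: sum.cong simp flip: of_real_power)
  then show ?thesis by (simp add: qform_def)
qed

lemma vsq_eq_cip: "complex_of_real (vsq v) = cip v v"
  by (auto simp: vsq_def cip_def complex_norm_square mult.commute simp flip: of_real_power intro!: sum.cong)

lemma vsq_unitary:
  assumes U: "U \<in> carrier_mat n n" "mat_adjoint U * U = 1\<^sub>m n" and v: "v \<in> carrier_vec n"
  shows "vsq (U *\<^sub>v v) = vsq v"
proof -
  have "mat_adjoint U *\<^sub>v (U *\<^sub>v v) = v"
    using U v by (simp add: assoc_mult_mat_vec[of _ n n _ n, symmetric])
  then have "complex_of_real (vsq (U *\<^sub>v v)) = complex_of_real (vsq v)"
    unfolding vsq_eq_cip using cip_adjoint[OF U(1) v, of "U *\<^sub>v v"] U v by simp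
  then show ?thesis by simp
qed

lemma psd_iff_qform:
  "psd n A \<longleftrightarrow> A \<in> carrier_mat n n \<and> mat_adjoint A = A \<and> (\<forall>v\<in>carrier_vec n. 0 \<le> qform A v)"
  unfolding psd_def qform_def cip_def by (intro conj_cong refl ball_cong) auto

lemma diag_of_mult [simp]: "diag_of n l * diag_of n k = diag_of n (\<lambda>i. l i * k i)"
proof (rule eq_matI)
  fix i j assume "i < dim_row (diag_of n (\<lambda>i. l i * k i))" "j < dim_col (diag_of n (\<lambda>i. l i * k i))"
  then have ij: "i < n" "j < n" by auto
  have "(diag_of n l * diag_of n k) $$ (i, j) = (\<Sum>m<n. diag_of n l $$ (i, m) * diag_of n k $$ (m, j))"
    by (rule mult_mat_entry) (use ij in auto)
  also have "\<dots> = (\<Sum>m<n. if m = i then (if i = j then complex_of_real (l i * k i) else 0) else 0)"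
    using ij by (intro sum.cong) auto
  also have "\<dots> = diag_of n (\<lambda>i. l i * k i) $$ (i, j)" using ij by simp
  finally show "(diag_of n l * diag_of n k) $$ (i, j) = diag_of n (\<lambda>i. l i * k i) $$ (i, j)" .
qed auto

lemma mult_diag_of_entry:
  assumes "A \<in> carrier_mat m n" "i < m" "j < n"
  shows "(A * diag_of n l) $$ (i, j) = A $$ (i, j) * complex_of_real (l j)"
proof -
  have "(A * diag_of n l) $$ (i, j) = (\<Sum>k<n. A $$ (i, k) * diag_of n l $$ (k, j))"
    by (rule mult_mat_entry) (use assms in auto)
  also have "\<dots> = (\<Sum>k<n. if k = j then A $$ (i, j) * complex_of_real (l j) else 0)"
    using assms by (intro sum.cong) auto
  finally show ?thesis using assms by simp
qed

section \<open>The positive part of the trace\<close>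

text \<open>Similar matrices share their characteristic polynomial, and that of a diagonal matrix
  splits with the diagonal entries as roots, counted with multiplicity. This lets
  \<open>trace_pos\<close> be computed from any unitary diagonalization.\<close>

lemma trace_pos_eigenvalues:
  fixes A :: "complex mat"
  assumes A: "A \<in> carrier_mat n n"
    and U: "U \<in> carrier_mat n n" "mat_adjoint U * U = 1\<^sub>m n" "U * mat_adjoint U = 1\<^sub>m n"
    and AU: "A = U * diag_of n l * mat_adjoint U"
  shows "trace_pos A = (\<Sum>i<n. max 0 (l i))"
proof -
  have "similar_mat_wit A (diag_of n l) U (mat_adjoint U)"
    by (rule similar_mat_witI[of _ _ n]) (use A U AU in auto)
  then have "char_poly A = char_poly (diag_of n l)"
    by (intro char_poly_similar) (auto simp: similar_mat_def)
  also have "\<dots> = (\<Prod>a\<leftarrow>diag_mat (diag_of n l). [:- a, 1:])"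
    by (rule char_poly_upper_triangular[of _ n]) auto
  also have "diag_mat (diag_of n l) = map (\<lambda>i. complex_of_real (l i)) [0..<n]"
    by (auto simp: diag_mat_def)
  finally have "char_poly A = (\<Prod>i\<leftarrow>[0..<n]. [:- complex_of_real (l i), 1:])"
    by (simp add: o_def)
  also have "\<dots> = (\<Prod>i<n. [:- complex_of_real (l i), 1:])"
    using prod.distinct_set_conv_list[of "[0..<n]" "\<lambda>i. [:- complex_of_real (l i), 1:]"]
    by (simp add: atLeast0LessThan)
  finally have "proots (char_poly A) = (\<Sum>i<n. {#complex_of_real (l i)#})"
    by (simp add: proots_prod)
  also have "\<dots> = image_mset (\<lambda>i. complex_of_real (l i)) (mset_set {..<n})"
    by (induction n) (auto simp: lessThan_Suc)
  finally show ?thesis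
    by (simp add: trace_pos_def image_mset.compositionality o_def flip: sum_unfold_sum_mset)
qed

text \<open>A sum of nonnegative terms vanishes only termwise, so no eigenvalue is positive. This is
  how a vanishing divergence becomes an operator inequality.\<close>

lemma trace_pos_eq_0_imp_qform_le_0:
  fixes A :: "complex mat"
  assumes A: "A \<in> carrier_mat n n" "mat_adjoint A = A" and "trace_pos A = 0" and v: "v \<in> carrier_vec n"
  shows "qform A v \<le> 0"
proof -
  obtain U l where U: "U \<in> carrier_mat n n" "mat_adjoint U * U = 1\<^sub>m n" "U * mat_adjoint U = 1\<^sub>m n"
    and l: "mat_adjoint U * A * U = diag_of n l" "A = U * diag_of n l * mat_adjoint U"
    using unitary_decomposition[OF A] by blast
  have "(\<Sum>i<n. max 0 (l i)) = 0"
    using trace_pos_eigenvalues[OF A(1) U l(2)] assms(3) by simp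
  then have le: "l i \<le> 0" if "i < n" for i
    using that by (subst (asm) sum_nonneg_eq_0_iff) (auto simp: max_def dest!: bspec[of _ _ i] split: if_splits)
  have "v = U *\<^sub>v (mat_adjoint U *\<^sub>v v)"
    using U v by (simp add: assoc_mult_mat_vec[of _ n n _ n, symmetric])
  then have "qform A v = qform (diag_of n l) (mat_adjoint U *\<^sub>v v)"
    using qform_congruence[OF U(1) A(1) mult_mat_vec_carrier[OF mat_adjoint_carrier[OF U(1)] v]] l(1) by simp
  also have "\<dots> = (\<Sum>i<n. l i * (cmod ((mat_adjoint U *\<^sub>v v) $ i))\<^sup>2)"
    by (rule qform_diag_of[OF mult_mat_vec_carrier[OF mat_adjoint_carrier[OF U(1)] v]])
  also have "\<dots> \<le> 0"
    by (rule sum_nonpos) (auto intro!: mult_nonpos_nonneg le)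
  finally show ?thesis .
qed

lemma mtrace_diff:
  assumes "A \<in> carrier_mat n n" "B \<in> carrier_mat n n"
  shows "mtrace (A - B) = mtrace A - mtrace B"
  using assms by (auto simp: mtrace_def sum_subtractf)

lemma mtrace_unitary_conj:
  assumes U: "U \<in> carrier_mat n n" "U * mat_adjoint U = 1\<^sub>m n" and A: "A \<in> carrier_mat n n"
  shows "mtrace (mat_adjoint U * A * U) = mtrace A"
proof -
  have "mtrace (mat_adjoint U * A * U) = mtrace (U * (mat_adjoint U * A))"
    by (rule mtrace_mult_commute[of _ n n]) (use U A in \<open>auto intro!: mult_carrier_mat[of _ n n]\<close>)
  also have "U * (mat_adjoint U * A) = A"
    using U A by (simp add: assoc_mult_mat[of U n n _ n _ n, symmetric])
  finally show ?thesis .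
qed

lemma mtrace_diag_of: "mtrace (diag_of n l) = complex_of_real (\<Sum>i<n. l i)"
  by (simp add: mtrace_def)

text \<open>For the eigenvalues of a traceless Hermitian matrix: the positive part carries half of
  the trace norm.\<close>

lemma sum_positive_part_eq_half_abs:
  assumes "(\<Sum>i<n. l i) = (0::real)"
  shows "2 * (\<Sum>i<n. max 0 (l i)) = (\<Sum>i<n. \<bar>l i\<bar>)"
proof -
  have "2 * max 0 x = \<bar>x\<bar> + x" for x :: real by (auto simp: max_def)
  then show ?thesis using assms by (simp add: sum_distrib_left sum.distrib)
qed

lemma mult_minus_add_distrib_mat:
  fixes A B M :: "complex mat"
  assumes "A \<in> carrier_mat n m" "B \<in> carrier_mat n m" "M \<in> carrier_mat k n"
  shows "M * (A - B) = M * A - M * B" "M * (A + B) = M * A + M * B"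
  using mult_minus_distrib_mat[OF assms(3,1,2)] mult_add_distrib_mat[OF assms(3,1,2)] by auto

text \<open>A Fuchs--van de Graaf inequality for arbitrary factorizations of the two states: with
  \<open>|a|\<^sup>2 - |b|\<^sup>2 = Re ((a - b) cnj (a + b))\<close> entrywise in an eigenbasis of the difference,
  it is Cauchy--Schwarz.\<close>
lemma trace_distance_factorized_le:
  assumes A: "A \<in> carrier_mat n m" "hs_sq A = 1" and B: "B \<in> carrier_mat n m" "hs_sq B = 1"
  shows "(trace_pos (A * mat_adjoint A - B * mat_adjoint B))\<^sup>2 \<le> 1 - (Re (hs_inner A B))\<^sup>2"
proof -
  let ?H = "A * mat_adjoint A - B * mat_adjoint B"
  have H: "?H \<in> carrier_mat n n" using A B by auto
  have cAA: "X * mat_adjoint X \<in> carrier_mat n n" if "X \<in> carrier_mat n m" for X :: "complex mat"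
    by (rule mult_carrier_mat[OF that mat_adjoint_carrier[OF that]])
  have AA: "mat_adjoint (X * mat_adjoint X) = X * mat_adjoint X" if "X \<in> carrier_mat n m" for X :: "complex mat"
    using mat_adjoint_mult[OF that mat_adjoint_carrier[OF that]] by simp
  have herm: "mat_adjoint ?H = ?H"
    using mat_adjoint_diff[OF cAA[OF A(1)] cAA[OF B(1)]] AA[OF A(1)] AA[OF B(1)] by simp
  obtain U l where U: "U \<in> carrier_mat n n" "mat_adjoint U * U = 1\<^sub>m n" "U * mat_adjoint U = 1\<^sub>m n"
    and l: "mat_adjoint U * ?H * U = diag_of n l" "?H = U * diag_of n l * mat_adjoint U"
    using unitary_decomposition[OF H herm] by blast
  note U' = mat_adjoint_carrier[OF U(1)]
  \<comment> \<open>Both factors have unit norm, so the difference of the two states is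
    traceless.\<close>
  have "mtrace (diag_of n l) = mtrace ?H"
    using mtrace_unitary_conj[OF U(1,3) H] l by simp
  also have "\<dots> = mtrace (A * mat_adjoint A) - mtrace (B * mat_adjoint B)"
    by (rule mtrace_diff[of _ n]) (use A B in auto)
  also have "\<dots> = 0" using A(2) B(2) by (simp add: mtrace_mult_adjoint)
  finally have "(\<Sum>i<n. l i) = 0" by (simp only: mtrace_diag_of of_real_eq_0_iff)
  then have tp: "2 * trace_pos ?H = (\<Sum>i<n. \<bar>l i\<bar>)"
    using trace_pos_eigenvalues[OF H U l(2)] sum_positive_part_eq_half_abs by simp
  define A' where "A' = mat_adjoint U * A"
  define B' where "B' = mat_adjoint U * B"
  have A': "A' \<in> carrier_mat n m" and B': "B' \<in> carrier_mat n m" using U' A B by (auto simp: A'_def B'_def)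
  \<comment> \<open>Passing to the eigenbasis of the difference only rotates each factor from the
    left.\<close>
  have fac: "mat_adjoint U * (X * mat_adjoint X) * U = (mat_adjoint U * X) * mat_adjoint (mat_adjoint U * X)"
    if X: "X \<in> carrier_mat n m" for X :: "complex mat"
  proof -
    note X' = mat_adjoint_carrier[OF X]
    have "(mat_adjoint U * X) * mat_adjoint (mat_adjoint U * X) = (mat_adjoint U * X) * (mat_adjoint X * U)"
      using mat_adjoint_mult[OF U' X] by simp
    also have "\<dots> = mat_adjoint U * X * mat_adjoint X * U"
      by (rule assoc_mult_mat[symmetric, OF mult_carrier_mat[OF U' X] X' U(1)])
    also have "\<dots> = mat_adjoint U * (X * mat_adjoint X) * U"
      by (simp add: assoc_mult_mat[OF U' X X'])
    finally show ?thesis by simp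
  qed
  have lH: "diag_of n l = A' * mat_adjoint A' - B' * mat_adjoint B'"
  proof -
    have "diag_of n l = mat_adjoint U * (A * mat_adjoint A) * U - mat_adjoint U * (B * mat_adjoint B) * U"
      unfolding l(1)[symmetric] using U(1) U' cAA[OF A(1)] cAA[OF B(1)]
      by (subst mult_minus_add_distrib_mat[OF cAA[OF A(1)] cAA[OF B(1)] U'])
         (simp_all add: minus_mult_distrib_mat[of _ n n _ _ n] mult_carrier_mat[of _ n n _ n])
    then show ?thesis using fac[OF A(1)] fac[OF B(1)] by (simp add: A'_def B'_def)
  qed
  have li: "\<bar>l i\<bar> \<le> (\<Sum>k<m. cmod ((A' - B') $$ (i, k)) * cmod ((A' + B') $$ (i, k)))" if i: "i < n" for i
  proof -
    have "complex_of_real (l i) = diag_of n l $$ (i, i)" using i by simp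
    also have "\<dots> = (A' * mat_adjoint A') $$ (i, i) - (B' * mat_adjoint B') $$ (i, i)"
      unfolding lH using i A' B' by (simp del: index_mult_mat(1))
    also have "\<dots> = complex_of_real (\<Sum>k<m. (cmod (A' $$ (i, k)))\<^sup>2 - (cmod (B' $$ (i, k)))\<^sup>2)"
      unfolding mult_adjoint_diag_entry[OF A' i] mult_adjoint_diag_entry[OF B' i] by (simp add: sum_subtractf)
    finally have "l i = (\<Sum>k<m. (cmod (A' $$ (i, k)))\<^sup>2 - (cmod (B' $$ (i, k)))\<^sup>2)"
      by (simp only: of_real_eq_iff)
    then have "\<bar>l i\<bar> \<le> (\<Sum>k<m. \<bar>(cmod (A' $$ (i, k)))\<^sup>2 - (cmod (B' $$ (i, k)))\<^sup>2\<bar>)"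
      by (simp add: sum_abs)
    also have "\<dots> \<le> (\<Sum>k<m. cmod ((A' - B') $$ (i, k)) * cmod ((A' + B') $$ (i, k)))"
    proof (rule sum_mono)
      fix k assume "k \<in> {..<m}"
      have "(cmod a)\<^sup>2 - (cmod b)\<^sup>2 = Re ((a - b) * cnj (a + b))" for a b
        unfolding cmod_power2 by (simp add: power2_eq_square algebra_simps)
      then have "\<bar>(cmod a)\<^sup>2 - (cmod b)\<^sup>2\<bar> \<le> cmod (a - b) * cmod (a + b)" for a b
        by (metis abs_Re_le_cmod complex_mod_cnj norm_mult)
      then show "\<bar>(cmod (A' $$ (i, k)))\<^sup>2 - (cmod (B' $$ (i, k)))\<^sup>2\<bar> \<le> cmod ((A' - B') $$ (i, k)) * cmod ((A' + B') $$ (i, k))"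
        using \<open>k \<in> {..<m}\<close> i A' B' by simp
    qed
    finally show ?thesis .
  qed
  have hs: "hs_sq X = (\<Sum>(i, k)\<in>{..<n} \<times> {..<m}. (cmod (X $$ (i, k)))\<^sup>2)" if "X \<in> carrier_mat n m" for X
    using that by (simp add: hs_sq_def sum.cartesian_product)
  have "2 * trace_pos ?H \<le> (\<Sum>i<n. \<Sum>k<m. cmod ((A' - B') $$ (i, k)) * cmod ((A' + B') $$ (i, k)))"
    unfolding tp by (intro sum_mono li) auto
  also have "\<dots> = (\<Sum>p\<in>{..<n} \<times> {..<m}. cmod ((A' - B') $$ p) * cmod ((A' + B') $$ p))"
    by (simp add: sum.cartesian_product case_prod_unfold)
  finally have "(2 * trace_pos ?H)\<^sup>2 \<le> (\<Sum>p\<in>{..<n} \<times> {..<m}. cmod ((A' - B') $$ p) * cmod ((A' + B') $$ p))\<^sup>2"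
    by (intro power_mono) (auto simp: tp intro!: sum_nonneg)
  also have "\<dots> \<le> hs_sq (A' - B') * hs_sq (A' + B')"
    using Cauchy_Schwarz_ineq_sum[of "\<lambda>p. cmod ((A' - B') $$ p)" "\<lambda>p. cmod ((A' + B') $$ p)" "{..<n} \<times> {..<m}"]
    by (subst (1 2) hs) (use A' B' in \<open>auto simp: case_prod_unfold\<close>)
  also have "\<dots> = hs_sq (A - B) * hs_sq (A + B)"
    unfolding A'_def B'_def mult_minus_add_distrib_mat[OF A(1) B(1) U', symmetric]
    using A(1) B(1) U' U by (subst (1 2) hs_sq_unitary_left[of _ n _ m]) auto
  \<comment> \<open>With \<open>r\<close> the real part of the inner product this is
    \<open>(2 - 2 * r) * (2 + 2 * r)\<close>; the factor 4 cancels against the square of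
    \<open>2 * trace_pos ?H\<close>.\<close>
  also have "\<dots> = 4 * (1 - (Re (hs_inner A B))\<^sup>2)"
    unfolding hs_sq_add_diff[OF A(1) B(1)] A(2) B(2) by (simp add: power2_eq_square algebra_simps)
  finally show ?thesis by (simp add: power2_eq_square)
qed

section \<open>Square roots of positive semidefinite matrices\<close>

lemma col_eq_mult_unit_vec:
  fixes A :: "complex mat"
  assumes "A \<in> carrier_mat m n" "j < n"
  shows "A *\<^sub>v unit_vec n j = col A j"
  using assms by (auto intro!: eq_vecI)

text \<open>Column \<open>j\<close> of \<open>U\<close> is the image of the unit vector
  \<open>j\<close>, where the diagonal form has value \<open>l j\<close>. This turns bounds on the
  form into bounds on the eigenvalues.\<close>

lemma eigenvalue_eq_qform:
  fixes A :: "complex mat"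
  assumes "A \<in> carrier_mat n n" "U \<in> carrier_mat n n" "mat_adjoint U * A * U = diag_of n l" "j < n"
  shows "qform A (col U j) = l j"
proof -
  have "qform A (col U j) = qform (diag_of n l) (unit_vec n j)"
    using qform_congruence[OF assms(2,1), of "unit_vec n j"] assms by (simp add: col_eq_mult_unit_vec)
  also have "\<dots> = (\<Sum>i<n. if i = j then l j else 0)"
    unfolding qform_diag_of[OF unit_vec_carrier] using assms by (intro sum.cong) auto
  finally show ?thesis using assms by simp
qed

lemma vsq_unit_vec: "j < n \<Longrightarrow> vsq (unit_vec n j) = 1"
proof -
  assume j: "j < n"
  have "vsq (unit_vec n j) = (\<Sum>i<n. if i = j then 1 else 0)"
    unfolding vsq_def using j by (intro sum.cong) auto
  then show ?thesis using j by simp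
qed

lemma vsq_unitary_col:
  assumes "U \<in> carrier_mat n n" "mat_adjoint U * U = 1\<^sub>m n" "j < n"
  shows "vsq (col U j) = 1"
  using vsq_unitary[OF assms(1,2), of "unit_vec n j"] assms by (simp add: col_eq_mult_unit_vec vsq_unit_vec)

lemma vsq_nonneg: "vsq v \<ge> 0"
  unfolding vsq_def by (intro sum_nonneg) auto

lemma hermitian_congruence:
  fixes U :: "complex mat"
  assumes U: "U \<in> carrier_mat n m" and A: "A \<in> carrier_mat n n" "mat_adjoint A = A"
  shows "mat_adjoint (mat_adjoint U * A * U) = mat_adjoint U * A * U"
proof -
  note U' = mat_adjoint_carrier[OF U]
  have "mat_adjoint (mat_adjoint U * A * U) = mat_adjoint U * (mat_adjoint A * U)"
    using mat_adjoint_mult[OF mult_carrier_mat[OF U' A(1)] U] mat_adjoint_mult[OF U' A(1)] by simp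
  also have "\<dots> = mat_adjoint U * A * U" using assoc_mult_mat[OF U' A(1) U] A by simp
  finally show ?thesis .
qed

text \<open>The converse transfer, from eigenvalues to the form: in the eigenbasis the form is a
  weighted sum of squares, and the change of basis preserves length.\<close>

lemma qform_unitary_diag_ge:
  assumes "U \<in> carrier_mat n n" "U * mat_adjoint U = 1\<^sub>m n" "\<And>i. i < n \<Longrightarrow> c \<le> l i" and v: "v \<in> carrier_vec n"
  shows "qform (U * diag_of n l * mat_adjoint U) v \<ge> c * vsq v"
proof -
  note U' = mat_adjoint_carrier[OF assms(1)]
  have "qform (U * diag_of n l * mat_adjoint U) v = qform (diag_of n l) (mat_adjoint U *\<^sub>v v)"
    using qform_congruence[OF U' diag_of_carrier v] by simp
  also have "\<dots> = (\<Sum>i<n. l i * (cmod ((mat_adjoint U *\<^sub>v v) $ i))\<^sup>2)"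
    by (rule qform_diag_of[OF mult_mat_vec_carrier[OF U' v]])
  also have "\<dots> \<ge> (\<Sum>i<n. c * (cmod ((mat_adjoint U *\<^sub>v v) $ i))\<^sup>2)"
    by (intro sum_mono mult_right_mono) (use assms in auto)
  also have "(\<Sum>i<n. c * (cmod ((mat_adjoint U *\<^sub>v v) $ i))\<^sup>2) = c * vsq (mat_adjoint U *\<^sub>v v)"
    using assms(1) by (simp add: vsq_def sum_distrib_left)
  also have "vsq (mat_adjoint U *\<^sub>v v) = vsq v"
    by (rule vsq_unitary[OF U' _ v]) (simp add: assms(2))
  finally show ?thesis by simp
qed

text \<open>Take square roots of the eigenvalues. The parameter \<open>c\<close> carries a lower
  bound through the root: \<open>c = 0\<close> gives the plain square root, \<open>c = 1\<close> the
  case that the Lipschitz estimate needs.\<close>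

lemma psd_sqrt:
  assumes "psd n R" and c: "c \<ge> 0" "\<And>v. v \<in> carrier_vec n \<Longrightarrow> c\<^sup>2 * vsq v \<le> qform R v"
  obtains Q where "Q \<in> carrier_mat n n" "mat_adjoint Q = Q" "Q * Q = R"
    "\<And>v. v \<in> carrier_vec n \<Longrightarrow> c * vsq v \<le> qform Q v"
proof -
  have R: "R \<in> carrier_mat n n" "mat_adjoint R = R" using assms(1) by (auto simp: psd_def)
  obtain U l where U: "U \<in> carrier_mat n n" "mat_adjoint U * U = 1\<^sub>m n" "U * mat_adjoint U = 1\<^sub>m n"
    and l: "mat_adjoint U * R * U = diag_of n l" "R = U * diag_of n l * mat_adjoint U"
    using unitary_decomposition[OF R] by blast
  note U' = mat_adjoint_carrier[OF U(1)]
  have le: "c\<^sup>2 \<le> l i" if "i < n" for i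
    using c(2)[of "col U i"] eigenvalue_eq_qform[OF R(1) U(1) l(1) that] vsq_unitary_col[OF U(1,2) that] U(1) that by simp
  have l0: "0 \<le> l i" if "i < n" for i
    using le[OF that] zero_le_power2[of c] by linarith
  define S where "S = diag_of n (\<lambda>i. sqrt (l i))"
  have S: "S \<in> carrier_mat n n" by (simp add: S_def)
  define Q where "Q = U * S * mat_adjoint U"
  have Q: "Q \<in> carrier_mat n n" using U S U' by (auto simp: Q_def intro!: mult_carrier_mat[of _ n n])
  have "mat_adjoint Q = Q"
    using hermitian_congruence[OF U' S] by (simp add: Q_def S_def)
  moreover have "Q * Q = R"
  proof -
    have "Q * Q = U * S * (mat_adjoint U * U) * S * mat_adjoint U"
      unfolding Q_def using U(1) U' S
      by (simp add: assoc_mult_mat[of _ n n _ n _ n] mult_carrier_mat[of _ n n _ n])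
    also have "\<dots> = U * (S * S) * mat_adjoint U"
      using U U' S by (simp add: assoc_mult_mat[of _ n n _ n _ n] mult_carrier_mat[of _ n n _ n])
    also have "S * S = diag_of n l"
      unfolding S_def diag_of_mult by (rule eq_matI) (auto simp: l0 simp flip: of_real_mult)
    finally show ?thesis using l by simp
  qed
  moreover have "c * vsq v \<le> qform Q v" if "v \<in> carrier_vec n" for v
    unfolding Q_def S_def
    by (rule qform_unitary_diag_ge[OF U(1,3) _ that]) (use c le in \<open>auto intro: real_le_rsqrt\<close>)
  ultimately show ?thesis using Q that by blast
qed

text \<open>Right multiplication by a diagonal matrix scales column \<open>j\<close> by
  \<open>l j\<close>.\<close>

lemma hs_sq_mult_diag_of_le:
  assumes A: "A \<in> carrier_mat m n" and b: "\<And>j. j < n \<Longrightarrow> \<bar>l j\<bar> \<le> b"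
  shows "hs_sq (A * diag_of n l) \<le> b\<^sup>2 * hs_sq A"
proof -
  have "hs_sq (A * diag_of n l) = (\<Sum>i<m. \<Sum>j<n. (cmod ((A * diag_of n l) $$ (i, j)))\<^sup>2)"
    using A by (simp add: hs_sq_def)
  also have "\<dots> = (\<Sum>i<m. \<Sum>j<n. (l j)\<^sup>2 * (cmod (A $$ (i, j)))\<^sup>2)"
    by (intro sum.cong refl)
       (simp add: mult_diag_of_entry[OF A] norm_mult power_mult_distrib mult.commute del: index_mult_mat(1))
  also have "\<dots> \<le> (\<Sum>i<m. \<Sum>j<n. b\<^sup>2 * (cmod (A $$ (i, j)))\<^sup>2)"
    by (intro sum_mono mult_right_mono) (auto simp: abs_le_square_iff[symmetric] intro: order_trans[OF b])
  also have "\<dots> = b\<^sup>2 * hs_sq A" using A by (simp add: hs_sq_def sum_distrib_left)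
  finally show ?thesis .
qed

text \<open>The square root is \<open>1/2\<close>-Lipschitz in operator norm on matrices bounded below by the identity:
  if \<open>(Q\<^sub>1 - Q\<^sub>2) u = \<mu> u\<close> then \<open>Q\<^sub>1\<^sup>2 - Q\<^sub>2\<^sup>2 = Q\<^sub>1 (Q\<^sub>1 - Q\<^sub>2) + (Q\<^sub>1 - Q\<^sub>2) Q\<^sub>2\<close> has quadratic form
  \<open>\<mu> (\<langle>u, Q\<^sub>1 u\<rangle> + \<langle>u, Q\<^sub>2 u\<rangle>)\<close> at \<open>u\<close>.\<close>
lemma hs_sq_sqrt_diff_le:
  assumes Q1: "Q\<^sub>1 \<in> carrier_mat n n" "mat_adjoint Q\<^sub>1 = Q\<^sub>1" "\<And>v. v \<in> carrier_vec n \<Longrightarrow> vsq v \<le> qform Q\<^sub>1 v"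
    and Q2: "Q\<^sub>2 \<in> carrier_mat n n" "mat_adjoint Q\<^sub>2 = Q\<^sub>2" "\<And>v. v \<in> carrier_vec n \<Longrightarrow> vsq v \<le> qform Q\<^sub>2 v"
    and c: "\<And>v. v \<in> carrier_vec n \<Longrightarrow> \<bar>qform (Q\<^sub>1 * Q\<^sub>1 - Q\<^sub>2 * Q\<^sub>2) v\<bar> \<le> c * vsq v"
    and C: "C \<in> carrier_mat m n"
  shows "hs_sq (C * (Q\<^sub>1 - Q\<^sub>2)) \<le> (c / 2)\<^sup>2 * hs_sq C"
proof -
  define D where "D = Q\<^sub>1 - Q\<^sub>2"
  have D: "D \<in> carrier_mat n n" using Q1 Q2 by (auto simp: D_def)
  have herm: "mat_adjoint D = D"
    unfolding D_def using mat_adjoint_diff[OF Q1(1) Q2(1)] Q1(2) Q2(2) by simp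
  obtain V l where V: "V \<in> carrier_mat n n" "mat_adjoint V * V = 1\<^sub>m n" "V * mat_adjoint V = 1\<^sub>m n"
    and l: "mat_adjoint V * D * V = diag_of n l" "D = V * diag_of n l * mat_adjoint V"
    using unitary_decomposition[OF D herm] by blast
  note V' = mat_adjoint_carrier[OF V(1)]
  have DV: "D * V = V * diag_of n l"
    unfolding l(2) assoc_mult_mat[OF mult_carrier_mat[OF V(1) diag_of_carrier] V' V(1)] V(2)
    by (rule right_mult_one_mat[OF mult_carrier_mat[OF V(1) diag_of_carrier]])
  have l_le: "\<bar>l j\<bar> \<le> c / 2" if j: "j < n" for j
  proof -
    define u where "u = col V j"
    have u: "u \<in> carrier_vec n" "vsq u = 1" using vsq_unitary_col[OF V(1,2) j] V(1) by (auto simp: u_def)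
    have Du: "D *\<^sub>v u = complex_of_real (l j) \<cdot>\<^sub>v u"
    proof -
      have "D *\<^sub>v u = col (D * V) j" unfolding u_def by (rule col_mult2[symmetric, OF D V(1) j])
      also have "\<dots> = complex_of_real (l j) \<cdot>\<^sub>v u"
        unfolding DV u_def using V(1) j
        by (intro eq_vecI) (auto simp: mult_diag_of_entry[OF V(1)] mult.commute simp del: index_mult_mat(1))
      finally show ?thesis .
    qed
    \<comment> \<open>In the first term \<open>D\<close> acts directly on the eigenvector
      \<open>u\<close>; in the second it does so after being moved to the other side of the inner
      product.\<close>
    have dec: "Q\<^sub>1 * Q\<^sub>1 - Q\<^sub>2 * Q\<^sub>2 = Q\<^sub>1 * D + D * Q\<^sub>2"
      unfolding D_def mult_minus_distrib_mat[OF Q1(1) Q1(1) Q2(1)] minus_mult_distrib_mat[OF Q1(1) Q2(1) Q2(1)]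
      by (rule eq_matI) (use Q1 Q2 in auto)
    have "qform (Q\<^sub>1 * D) u = l j * qform Q\<^sub>1 u"
      using Q1(1) D u Du by (simp add: qform_def assoc_mult_mat_vec[of _ n n _ n] mult_mat_vec[of _ n n] cip_smult_right)
    moreover have "qform (D * Q\<^sub>2) u = l j * qform Q\<^sub>2 u"
    proof -
      have "cip u (D *\<^sub>v (Q\<^sub>2 *\<^sub>v u)) = cip (D *\<^sub>v u) (Q\<^sub>2 *\<^sub>v u)"
        using cip_adjoint[OF D u(1), of "Q\<^sub>2 *\<^sub>v u"] Q2 u herm by simp
      also have "\<dots> = complex_of_real (l j) * cip u (Q\<^sub>2 *\<^sub>v u)"
        unfolding Du using Q2 u by (subst cip_smult_left) auto
      finally show ?thesis
        using Q2(1) D u by (simp add: qform_def assoc_mult_mat_vec[of _ n n _ n])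
    qed
    ultimately have "qform (Q\<^sub>1 * Q\<^sub>1 - Q\<^sub>2 * Q\<^sub>2) u = l j * (qform Q\<^sub>1 u + qform Q\<^sub>2 u)"
      unfolding dec using Q1 Q2 D u by (simp add: qform_add[of _ n] mult_carrier_mat[of _ n n _ n] algebra_simps)
    then have "\<bar>l j\<bar> * (qform Q\<^sub>1 u + qform Q\<^sub>2 u) \<le> c"
      using c[OF u(1)] u(2) Q1(3)[OF u(1)] Q2(3)[OF u(1)] by (simp add: abs_mult)
    \<comment> \<open>Each form is at least \<open>vsq u = 1\<close>; the resulting factor 2 is the
      source of the Lipschitz constant 1/2.\<close>
    moreover have "\<bar>l j\<bar> * 2 \<le> \<bar>l j\<bar> * (qform Q\<^sub>1 u + qform Q\<^sub>2 u)"
      using u(2) Q1(3)[OF u(1)] Q2(3)[OF u(1)] by (intro mult_left_mono) auto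
    ultimately show ?thesis by simp
  qed
  have "hs_sq (C * D) = hs_sq (C * D * V)"
    by (rule hs_sq_unitary_right[symmetric, OF V(1,3)]) (use C D in auto)
  also have "C * D * V = C * V * diag_of n l"
    using C D V DV by (simp add: assoc_mult_mat[of _ m n _ n _ n])
  also have "hs_sq \<dots> \<le> (c / 2)\<^sup>2 * hs_sq (C * V)"
    by (rule hs_sq_mult_diag_of_le[OF _ l_le]) (use C V in auto)
  also have "hs_sq (C * V) = hs_sq C" by (rule hs_sq_unitary_right[OF V(1,3) C])
  finally show ?thesis by (simp add: D_def)
qed

section \<open>Factorizations relative to a reference state\<close>

lemma vsq_eq_0_imp:
  assumes "vsq v = 0" "v \<in> carrier_vec n"
  shows "v = 0\<^sub>v n"
proof -
  have "\<forall>i<n. v $ i = 0"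
    using assms unfolding vsq_def by (subst (asm) sum_nonneg_eq_0_iff) auto
  then show ?thesis using assms by (intro eq_vecI) auto
qed

text \<open>The form of \<open>Q * Q\<close> at \<open>u\<close> is the squared length of
  \<open>Q *\<^sub>v u\<close>.\<close>

lemma hermitian_square_kernel:
  fixes Q :: "complex mat"
  assumes Q: "Q \<in> carrier_mat n n" "mat_adjoint Q = Q" and u: "u \<in> carrier_vec n"
    and "qform (Q * Q) u \<le> 0"
  shows "Q *\<^sub>v u = 0\<^sub>v n"
proof -
  have Qu: "Q *\<^sub>v u \<in> carrier_vec n" using Q u by auto
  have "cip u (Q * Q *\<^sub>v u) = cip (Q *\<^sub>v u) (Q *\<^sub>v u)"
    using cip_adjoint[OF Q(1) u Qu] Q u by (simp add: assoc_mult_mat_vec[of _ n n _ n])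
  then have "qform (Q * Q) u = vsq (Q *\<^sub>v u)"
    by (simp add: qform_def flip: vsq_eq_cip)
  then have "vsq (Q *\<^sub>v u) = 0" using assms(4) vsq_nonneg[of "Q *\<^sub>v u"] by simp
  then show ?thesis using Qu by (rule vsq_eq_0_imp)
qed

text \<open>For \<open>\<omega> \<le> \<rho> \<le> k \<omega>\<close> one can write \<open>\<rho> = C R C\<^sup>*\<close> with \<open>C C\<^sup>* = \<omega>\<close> and \<open>R \<ge> 1\<close>, where
  \<open>R = \<omega>\<^sup>-\<^sup>1\<^sup>/\<^sup>2 \<rho> \<omega>\<^sup>-\<^sup>1\<^sup>/\<^sup>2\<close> on the support of \<open>\<omega>\<close> and \<open>R = 1\<close> on its kernel. The matrix \<open>G\<close> is the
  pseudo-inverse of \<open>C\<^sup>*\<close>, and \<open>K\<close> the projection onto the kernel in the eigenbasis.\<close>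
lemma relative_factorization:
  assumes \<omega>: "psd n \<omega>"
  obtains C G K where "C \<in> carrier_mat n n" "G \<in> carrier_mat n n" "K \<in> carrier_mat n n"
    "mat_adjoint K = K" "C * mat_adjoint C = \<omega>"
    "\<And>v. v \<in> carrier_vec n \<Longrightarrow> vsq v = qform \<omega> (G *\<^sub>v v) + qform K v"
    "\<And>v. v \<in> carrier_vec n \<Longrightarrow> 0 \<le> qform K v"
    "\<And>\<rho> k. psd n \<rho> \<Longrightarrow> (\<And>v. v \<in> carrier_vec n \<Longrightarrow> qform \<rho> v \<le> k * qform \<omega> v) \<Longrightarrow>
       C * (mat_adjoint G * \<rho> * G + K) * mat_adjoint C = \<rho>"
proof -
  have o: "\<omega> \<in> carrier_mat n n" "mat_adjoint \<omega> = \<omega>" using \<omega> by (auto simp: psd_def)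
  obtain U w where U: "U \<in> carrier_mat n n" "mat_adjoint U * U = 1\<^sub>m n" "U * mat_adjoint U = 1\<^sub>m n"
    and w: "mat_adjoint U * \<omega> * U = diag_of n w" "\<omega> = U * diag_of n w * mat_adjoint U"
    using unitary_decomposition[OF o] by blast
  note U' = mat_adjoint_carrier[OF U(1)]
  note assoc = assoc_mult_mat[of _ n n _ n _ n] and cm = mult_carrier_mat[of _ n n _ n]
  have w0: "0 \<le> w i" if "i < n" for i
  proof -
    have "col U i \<in> carrier_vec n" using U by auto
    then show ?thesis
      using eigenvalue_eq_qform[OF o(1) U(1) w(1) that] \<omega> unfolding psd_iff_qform by metis
  qed
  define S where "S = diag_of n (\<lambda>i. sqrt (w i))"
  \<comment> \<open>\<open>T\<close> is the pseudo-inverse of \<open>S\<close>: it is 0 where the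
    eigenvalue of \<open>\<omega>\<close> vanishes, and \<open>K\<close> takes over there.\<close>
  define T where "T = diag_of n (\<lambda>i. if w i = 0 then 0 else 1 / sqrt (w i))"
  define K where "K = diag_of n (\<lambda>i. if w i = 0 then 1 else 0)"
  have car: "S \<in> carrier_mat n n" "T \<in> carrier_mat n n" "K \<in> carrier_mat n n"
    and self: "mat_adjoint S = S" "mat_adjoint T = T" "mat_adjoint K = K"
    by (simp_all add: S_def T_def K_def)
  define C where "C = U * S"
  define G where "G = U * T"
  have C: "C \<in> carrier_mat n n" and G: "G \<in> carrier_mat n n" using U car by (auto simp: C_def G_def)
  have C': "mat_adjoint C = S * mat_adjoint U" and G': "mat_adjoint G = T * mat_adjoint U"
    using mat_adjoint_mult[OF U(1) car(1)] mat_adjoint_mult[OF U(1) car(2)] self by (simp_all add: C_def G_def)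
  have SS: "S * S = diag_of n w"
    unfolding S_def diag_of_mult by (rule eq_matI) (auto simp: w0 simp flip: of_real_mult)
  have SK: "S * K = 0\<^sub>m n n"
    unfolding S_def K_def diag_of_mult by (rule eq_matI) auto
  have CC: "C * mat_adjoint C = \<omega>"
    unfolding C' unfolding C_def using U(1) U' car SS w(2) by (simp add: assoc cm) (simp flip: assoc add: cm SS)
  have vsq: "vsq v = qform \<omega> (G *\<^sub>v v) + qform K v" if v: "v \<in> carrier_vec n" for v
  proof -
    have Tv: "T *\<^sub>v v \<in> carrier_vec n" using car v by auto
    have "qform \<omega> (G *\<^sub>v v) = qform \<omega> (U *\<^sub>v (T *\<^sub>v v))"
      unfolding G_def using U car v by (simp add: assoc_mult_mat_vec[of _ n n _ n])
    also have "\<dots> = qform (diag_of n w) (T *\<^sub>v v)"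
      using qform_congruence[OF U(1) o(1) Tv] w(1) by simp
    also have "\<dots> = qform (mat_adjoint T * diag_of n w * T) v"
      by (rule qform_congruence[symmetric, OF car(2) diag_of_carrier v])
    finally have "qform \<omega> (G *\<^sub>v v) = (\<Sum>i<n. (if w i = 0 then 0 else 1) * (cmod (v $ i))\<^sup>2)"
      unfolding self unfolding T_def diag_of_mult qform_diag_of[OF v]
      by (auto intro!: sum.cong simp: w0 field_simps simp flip: power2_eq_square)
    moreover have "qform K v = (\<Sum>i<n. (if w i = 0 then 1 else 0) * (cmod (v $ i))\<^sup>2)"
      unfolding K_def by (rule qform_diag_of[OF v])
    moreover have "vsq v = (\<Sum>i<n. (if w i = 0 then 0 else 1) * (cmod (v $ i))\<^sup>2 + (if w i = 0 then 1 else 0) * (cmod (v $ i))\<^sup>2)"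
      using v unfolding vsq_def by (intro sum.cong) auto
    ultimately show ?thesis by (simp only: sum.distrib)
  qed
  have K0: "0 \<le> qform K v" if "v \<in> carrier_vec n" for v
    unfolding K_def qform_diag_of[OF that] by (intro sum_nonneg) auto
  have rep: "C * (mat_adjoint G * \<rho> * G + K) * mat_adjoint C = \<rho>"
    if \<rho>: "psd n \<rho>" and le: "\<And>v. v \<in> carrier_vec n \<Longrightarrow> qform \<rho> v \<le> k * qform \<omega> v" for \<rho> k
  proof -
    have r: "\<rho> \<in> carrier_mat n n" using \<rho> by (auto simp: psd_def)
    obtain Q where Q: "Q \<in> carrier_mat n n" "mat_adjoint Q = Q" "Q * Q = \<rho>"
      using psd_sqrt[OF \<rho>, of 0] \<rho> by (auto simp: psd_iff_qform)
    \<comment> \<open>The bound by \<open>k * qform \<omega> v\<close> forces \<open>\<rho>\<close>,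
      hence its root \<open>Q\<close>, to vanish on the kernel of \<open>\<omega>\<close>.\<close>
    have ker: "col (Q * U) j = 0\<^sub>v n" if j: "j < n" "w j = 0" for j
    proof -
      have u: "col U j \<in> carrier_vec n" using U by auto
      have "qform \<rho> (col U j) \<le> 0"
        using le[OF u] eigenvalue_eq_qform[OF o(1) U(1) w(1) j(1)] j(2) by simp
      then have "Q *\<^sub>v col U j = 0\<^sub>v n" using hermitian_square_kernel[OF Q(1,2) u] Q(3) by simp
      then show ?thesis using col_mult2[OF Q(1) U(1) j(1)] by simp
    qed
    have QU: "Q * U \<in> carrier_mat n n" using Q U by auto
    \<comment> \<open>\<open>T * S\<close> is the projection onto the support of
      \<open>\<omega>\<close> in the eigenbasis; the columns of \<open>Q * U\<close> that it removes
      are already zero.\<close>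
    have "Q * U * (T * S) = Q * U"
    proof (rule eq_matI)
      fix i j assume ij: "i < dim_row (Q * U)" "j < dim_col (Q * U)"
      then have ij': "i < n" "j < n" using Q U by auto
      have "(Q * U * (T * S)) $$ (i, j) = (Q * U) $$ (i, j) * complex_of_real ((if w j = 0 then 0 else 1 / sqrt (w j)) * sqrt (w j))"
        unfolding T_def S_def diag_of_mult by (rule mult_diag_of_entry[OF QU ij'])
      also have "\<dots> = (Q * U) $$ (i, j)"
      proof (cases "w j = 0")
        case True
        then have "col (Q * U) j $ i = 0" using ker[OF ij'(2)] ij' by simp
        then show ?thesis using True ij by (simp del: index_mult_mat(1))
      qed simp
      finally show "(Q * U * (T * S)) $$ (i, j) = (Q * U) $$ (i, j)" .
    qed (use Q U car in auto)
    then have "Q * U * (T * S) * mat_adjoint U = Q * U * mat_adjoint U" by simp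
    also have "\<dots> = Q" using Q(1) U U' by (simp add: assoc)
    finally have QGC: "Q * (G * mat_adjoint C) = Q"
      unfolding C' G_def using Q(1) U(1) U' car by (simp add: assoc cm)
    have GC: "G * mat_adjoint C \<in> carrier_mat n n" using G C by auto
    have "C * (mat_adjoint G * \<rho> * G + K) * mat_adjoint C
      = C * (mat_adjoint G * \<rho> * G) * mat_adjoint C + C * K * mat_adjoint C"
      using C G mat_adjoint_carrier[OF C] mat_adjoint_carrier[OF G] r car
      by (simp add: mult_add_distrib_mat[of _ n n _ n] add_mult_distrib_mat[of _ n n _ _ n] cm)
    \<comment> \<open>\<open>S\<close> vanishes on the range of \<open>K\<close>, so the part added
      on the kernel is cut off again.\<close>
    also have "C * K * mat_adjoint C = 0\<^sub>m n n"
      unfolding C' unfolding C_def using U(1) U' car SK by (simp add: assoc cm)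
    also have "C * (mat_adjoint G * \<rho> * G) * mat_adjoint C = mat_adjoint (Q * (G * mat_adjoint C)) * (Q * (G * mat_adjoint C))"
      unfolding mat_adjoint_mult[OF Q(1) GC] mat_adjoint_mult[OF G mat_adjoint_carrier[OF C]] Q(2) Q(3)[symmetric]
      using C G mat_adjoint_carrier[OF C] mat_adjoint_carrier[OF G] Q(1)
      by (simp add: assoc cm)
    also have "\<dots> = \<rho>" unfolding QGC using Q by simp
    finally show ?thesis using r by simp
  qed
  show ?thesis by (rule that[OF C G car(3) self(3) CC]) (fact vsq, fact K0, fact rep)
qed

text \<open>The factors are \<open>C * Q1\<close> and \<open>C * Q2\<close>, with \<open>Q1\<close>
  and \<open>Q2\<close> the roots of the two matrices taken relative to \<open>\<omega>\<close>. The
  lower bounds make the relative matrices at least the identity, the upper bounds confine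
  \<open>\<rho>\<close> and \<open>\<sigma>\<close> to the support of \<open>\<omega>\<close>, and
  \<open>diff\<close> bounds the relative difference by \<open>c\<close>. The Lipschitz estimate
  then applies, with \<open>hs_sq C\<close> equal to the trace of \<open>\<omega>\<close>.\<close>

lemma close_factorizations:
  assumes \<omega>: "psd n \<omega>" and \<rho>: "psd n \<rho>" and \<sigma>: "psd n \<sigma>"
    and \<rho>_lower: "\<And>v. v \<in> carrier_vec n \<Longrightarrow> qform \<omega> v \<le> qform \<rho> v"
    and \<rho>_upper: "\<And>v. v \<in> carrier_vec n \<Longrightarrow> qform \<rho> v \<le> k * qform \<omega> v"
    and \<sigma>_lower: "\<And>v. v \<in> carrier_vec n \<Longrightarrow> qform \<omega> v \<le> qform \<sigma> v"
    and \<sigma>_upper: "\<And>v. v \<in> carrier_vec n \<Longrightarrow> qform \<sigma> v \<le> k * qform \<omega> v"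
    and diff: "\<And>v. v \<in> carrier_vec n \<Longrightarrow> \<bar>qform \<rho> v - qform \<sigma> v\<bar> \<le> c * qform \<omega> v"
    and c: "c \<ge> 0"
  obtains A B where "A \<in> carrier_mat n n" "B \<in> carrier_mat n n"
    "A * mat_adjoint A = \<rho>" "B * mat_adjoint B = \<sigma>" "hs_sq (A - B) \<le> (c / 2)\<^sup>2 * Re (mtrace \<omega>)"
proof -
  obtain C G K where C: "C \<in> carrier_mat n n" and G: "G \<in> carrier_mat n n" and K: "K \<in> carrier_mat n n"
    "mat_adjoint K = K" and CC: "C * mat_adjoint C = \<omega>"
    and vsq: "\<And>v. v \<in> carrier_vec n \<Longrightarrow> vsq v = qform \<omega> (G *\<^sub>v v) + qform K v"
    and K0: "\<And>v. v \<in> carrier_vec n \<Longrightarrow> 0 \<le> qform K v"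
    and rep: "\<And>\<rho> k. psd n \<rho> \<Longrightarrow> (\<And>v. v \<in> carrier_vec n \<Longrightarrow> qform \<rho> v \<le> k * qform \<omega> v) \<Longrightarrow>
       C * (mat_adjoint G * \<rho> * G + K) * mat_adjoint C = \<rho>"
    using relative_factorization[OF \<omega>] by metis
  note assoc = assoc_mult_mat[of _ n n _ n _ n] and cm = mult_carrier_mat[of _ n n _ n]
  note G' = mat_adjoint_carrier[OF G] and C' = mat_adjoint_carrier[OF C]
  define rel where "rel \<tau> = mat_adjoint G * \<tau> * G + K" for \<tau>
  have rel_form: "qform (rel \<tau>) v = qform \<tau> (G *\<^sub>v v) + qform K v"
    if "\<tau> \<in> carrier_mat n n" "v \<in> carrier_vec n" for \<tau> v
    unfolding rel_def using that G G' K
    by (simp add: qform_add[of _ n] qform_congruence[of _ n n] cm)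
  have Gv: "G *\<^sub>v v \<in> carrier_vec n" if "v \<in> carrier_vec n" for v using G that by auto
  have root: "\<exists>Q. Q \<in> carrier_mat n n \<and> mat_adjoint Q = Q \<and> Q * Q = rel \<tau> \<and> (\<forall>v\<in>carrier_vec n. vsq v \<le> qform Q v)"
    if \<tau>: "psd n \<tau>" and low: "\<And>v. v \<in> carrier_vec n \<Longrightarrow> qform \<omega> v \<le> qform \<tau> v" for \<tau>
  proof -
    have t: "\<tau> \<in> carrier_mat n n" "mat_adjoint \<tau> = \<tau>" using \<tau> by (auto simp: psd_def)
    have ge: "vsq v \<le> qform (rel \<tau>) v" if v: "v \<in> carrier_vec n" for v
      using vsq[OF v] rel_form[OF t(1) v] low[OF Gv[OF v]] by simp
    have "psd n (rel \<tau>)"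
      unfolding psd_iff_qform
    proof (intro conjI ballI)
      show "rel \<tau> \<in> carrier_mat n n" unfolding rel_def using G G' K t by (simp add: cm)
      show "mat_adjoint (rel \<tau>) = rel \<tau>"
        unfolding rel_def using G G' K t
        by (simp add: mat_adjoint_add[of _ n n] cm hermitian_congruence[of _ n n])
      show "0 \<le> qform (rel \<tau>) v" if "v \<in> carrier_vec n" for v
        using ge[OF that] vsq_nonneg[of v] by simp
    qed
    from psd_sqrt[OF this, of 1] ge show ?thesis by (metis mult_1 one_power2 zero_le_one)
  qed
  obtain Q1 where Q1: "Q1 \<in> carrier_mat n n" "mat_adjoint Q1 = Q1" "Q1 * Q1 = rel \<rho>"
    "\<And>v. v \<in> carrier_vec n \<Longrightarrow> vsq v \<le> qform Q1 v" using root[OF \<rho> \<rho>_lower] by blast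
  obtain Q2 where Q2: "Q2 \<in> carrier_mat n n" "mat_adjoint Q2 = Q2" "Q2 * Q2 = rel \<sigma>"
    "\<And>v. v \<in> carrier_vec n \<Longrightarrow> vsq v \<le> qform Q2 v" using root[OF \<sigma> \<sigma>_lower] by blast
  have fac: "C * Q * mat_adjoint (C * Q) = \<tau>"
    if Q: "Q \<in> carrier_mat n n" "mat_adjoint Q = Q" "Q * Q = rel \<tau>" and \<tau>: "psd n \<tau>"
      and up: "\<And>v. v \<in> carrier_vec n \<Longrightarrow> qform \<tau> v \<le> k * qform \<omega> v" for Q \<tau>
  proof -
    have "C * Q * mat_adjoint (C * Q) = C * (Q * Q) * mat_adjoint C"
      unfolding mat_adjoint_mult[OF C Q(1)] Q(2) using C C' Q(1) by (simp add: assoc cm)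
    then show ?thesis using rep[OF \<tau> up] Q(3) by (simp add: rel_def)
  qed
  have rs: "\<rho> \<in> carrier_mat n n" "\<sigma> \<in> carrier_mat n n" using \<rho> \<sigma> by (auto simp: psd_def)
  have "hs_sq (C * (Q1 - Q2)) \<le> (c / 2)\<^sup>2 * hs_sq C"
  proof (rule hs_sq_sqrt_diff_le[OF Q1(1,2,4) Q2(1,2,4) _ C])
    fix v :: "complex vec" assume v: "v \<in> carrier_vec n"
    \<comment> \<open>\<open>K\<close> occurs in both relative matrices and cancels.\<close>
    have "qform (Q1 * Q1 - Q2 * Q2) v = qform \<rho> (G *\<^sub>v v) - qform \<sigma> (G *\<^sub>v v)"
      using qform_diff[OF cm[OF Q1(1) Q1(1)] cm[OF Q2(1) Q2(1)] v]
      by (simp add: Q1(3) Q2(3) rel_form[OF rs(1) v] rel_form[OF rs(2) v])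
    also have "\<bar>\<dots>\<bar> \<le> c * qform \<omega> (G *\<^sub>v v)" by (rule diff[OF Gv[OF v]])
    also have "\<dots> \<le> c * vsq v"
      using vsq[OF v] K0[OF v] c by (intro mult_left_mono) auto
    finally show "\<bar>qform (Q1 * Q1 - Q2 * Q2) v\<bar> \<le> c * vsq v" .
  qed
  moreover have "hs_sq C = Re (mtrace \<omega>)" using mtrace_mult_adjoint[of C] CC by simp
  ultimately show ?thesis
    using that[of "C * Q1" "C * Q2"] fac[OF Q1(1-3) \<rho> \<rho>_upper] fac[OF Q2(1-3) \<sigma> \<sigma>_upper] C Q1(1) Q2(1)
    by (simp add: mult_minus_add_distrib_mat[of _ n n _ C n])
qed

section \<open>Tensor powers\<close>

text \<open>Writing \<open>k = a * q + b\<close> is the index convention of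
  \<open>tensor_mat\<close>; the sum is grouped into blocks of length \<open>q\<close>.\<close>

lemma sum_div_mod:
  fixes h :: "nat \<Rightarrow> nat \<Rightarrow> 'a :: comm_monoid_add"
  shows "(\<Sum>k<m * q. h (k div q) (k mod q)) = (\<Sum>a<m. \<Sum>b<q. h a b)"
proof -
  have "(\<Sum>k<m * q. h (k div q) (k mod q)) = (\<Sum>a<m. \<Sum>k\<in>{a * q..<a * q + q}. h (k div q) (k mod q))"
    by (rule sum.nat_group[symmetric])
  also have "\<dots> = (\<Sum>a<m. \<Sum>b<q. h a b)"
  proof (rule sum.cong[OF refl])
    fix a
    show "(\<Sum>k\<in>{a * q..<a * q + q}. h (k div q) (k mod q)) = (\<Sum>b<q. h a b)"
      using sum.shift_bounds_nat_ivl[of "\<lambda>k. h (k div q) (k mod q)" 0 "a * q" q]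
      by (simp add: atLeast0LessThan add.commute)
  qed
  finally show ?thesis .
qed

lemma tensor_mat_carrier:
  "A \<in> carrier_mat n m \<Longrightarrow> B \<in> carrier_mat p q \<Longrightarrow> tensor_mat A B \<in> carrier_mat (n * p) (m * q)"
  by (auto simp: tensor_mat_def)

lemma tensor_mat_entry:
  assumes "A \<in> carrier_mat n m" "B \<in> carrier_mat p q" "i < n * p" "j < m * q"
  shows "tensor_mat A B $$ (i, j) = A $$ (i div p, j div q) * B $$ (i mod p, j mod q)"
  using assms by (auto simp: tensor_mat_def)

lemma div_mod_less:
  fixes i :: nat
  assumes "i < n * p"
  shows "i div p < n" "i mod p < p"
  using assms by (auto simp: less_mult_imp_div_less intro!: mod_less_divisor gr0I)

text \<open>The mixed-product rule for matrices and their adjoints, by which factorizations of two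
  states give one of their tensor product. Entrywise, the sum over the joint inner index
  factors.\<close>

lemma tensor_mat_mult_adjoint:
  assumes A: "A \<in> carrier_mat n m" and B: "B \<in> carrier_mat p q"
  shows "tensor_mat (A * mat_adjoint A) (B * mat_adjoint B) = tensor_mat A B * mat_adjoint (tensor_mat A B)"
proof (rule eq_matI)
  note T = tensor_mat_carrier[OF A B]
  fix i j assume "i < dim_row (tensor_mat A B * mat_adjoint (tensor_mat A B))"
    "j < dim_col (tensor_mat A B * mat_adjoint (tensor_mat A B))"
  then have ij: "i < n * p" "j < n * p" using T by auto
  note i = div_mod_less[OF ij(1)] and j = div_mod_less[OF ij(2)]
  have entry: "(X * mat_adjoint X) $$ (r, s) = (\<Sum>k<m. X $$ (r, k) * cnj (X $$ (s, k)))"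
    if X: "X \<in> carrier_mat n m" "r < n" "s < n" for X :: "complex mat" and r s n m
    unfolding mult_mat_entry[OF X(1) mat_adjoint_carrier[OF X(1)] X(2,3)] using X by (auto intro!: sum.cong)
  have "(tensor_mat A B * mat_adjoint (tensor_mat A B)) $$ (i, j)
    = (\<Sum>k<m * q. (A $$ (i div p, k div q) * B $$ (i mod p, k mod q))
        * cnj (A $$ (j div p, k div q) * B $$ (j mod p, k mod q)))"
    unfolding entry[OF T ij] by (intro sum.cong refl) (auto simp: tensor_mat_entry[OF A B] ij)
  also have "\<dots> = (\<Sum>a<m. \<Sum>b<q. (A $$ (i div p, a) * B $$ (i mod p, b)) * cnj (A $$ (j div p, a) * B $$ (j mod p, b)))"
    by (rule sum_div_mod[of "\<lambda>a b. (A $$ (i div p, a) * B $$ (i mod p, b)) * cnj (A $$ (j div p, a) * B $$ (j mod p, b))"])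
  also have "\<dots> = (\<Sum>a<m. A $$ (i div p, a) * cnj (A $$ (j div p, a))) * (\<Sum>b<q. B $$ (i mod p, b) * cnj (B $$ (j mod p, b)))"
    unfolding sum_product by (intro sum.cong refl) simp
  also have "\<dots> = (A * mat_adjoint A) $$ (i div p, j div p) * (B * mat_adjoint B) $$ (i mod p, j mod p)"
    using entry[OF A i(1) j(1)] entry[OF B i(2) j(2)] by simp
  also have "\<dots> = tensor_mat (A * mat_adjoint A) (B * mat_adjoint B) $$ (i, j)"
    by (rule tensor_mat_entry[symmetric, of _ n n _ p p]) (use A B ij in auto)
  finally show "tensor_mat (A * mat_adjoint A) (B * mat_adjoint B) $$ (i, j)
    = (tensor_mat A B * mat_adjoint (tensor_mat A B)) $$ (i, j)" by simp
qed (use A B in \<open>auto simp: tensor_mat_def\<close>)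

text \<open>Both joint indices split into pairs, and the summand separates. This multiplicativity is
  what controls many copies.\<close>

lemma hs_inner_tensor_mat:
  assumes A: "A \<in> carrier_mat n m" "A' \<in> carrier_mat n m" and B: "B \<in> carrier_mat p q" "B' \<in> carrier_mat p q"
  shows "hs_inner (tensor_mat A B) (tensor_mat A' B') = hs_inner A A' * hs_inner B B'"
proof -
  have "hs_inner (tensor_mat A B) (tensor_mat A' B')
    = (\<Sum>i<n * p. \<Sum>j<m * q. A $$ (i div p, j div q) * B $$ (i mod p, j mod q)
        * cnj (A' $$ (i div p, j div q) * B' $$ (i mod p, j mod q)))"
    using tensor_mat_carrier[OF A(1) B(1)]
    by (simp add: hs_inner_def tensor_mat_entry[OF A(1) B(1)] tensor_mat_entry[OF A(2) B(2)])
  also have "\<dots> = (\<Sum>i<n * p. \<Sum>a<m. \<Sum>b<q. A $$ (i div p, a) * B $$ (i mod p, b)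
        * cnj (A' $$ (i div p, a) * B' $$ (i mod p, b)))"
    by (intro sum.cong refl sum_div_mod[where h="\<lambda>a b. A $$ (_ div p, a) * B $$ (_ mod p, b)
        * cnj (A' $$ (_ div p, a) * B' $$ (_ mod p, b))"])
  also have "\<dots> = (\<Sum>i<n. \<Sum>j<p. \<Sum>a<m. \<Sum>b<q. A $$ (i, a) * B $$ (j, b)
        * cnj (A' $$ (i, a) * B' $$ (j, b)))"
    by (rule sum_div_mod[where h="\<lambda>i j. \<Sum>a<m. \<Sum>b<q. A $$ (i, a) * B $$ (j, b)
        * cnj (A' $$ (i, a) * B' $$ (j, b))"])
  also have "\<dots> = (\<Sum>i<n. \<Sum>j<p. (\<Sum>a<m. A $$ (i, a) * cnj (A' $$ (i, a))) * (\<Sum>b<q. B $$ (j, b) * cnj (B' $$ (j, b))))"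
    unfolding sum_product by (intro sum.cong refl) simp
  also have "\<dots> = hs_inner A A' * hs_inner B B'"
    using A B by (simp add: hs_inner_def sum_product)
  finally show ?thesis .
qed

lemma hs_inner_self: "hs_inner A A = complex_of_real (hs_sq A)"
  by (simp add: hs_inner_def hs_sq_def complex_norm_square del: of_real_power)

lemma tensor_pow_carrier: "A \<in> carrier_mat n m \<Longrightarrow> tensor_pow A k \<in> carrier_mat (n ^ k) (m ^ k)"
proof (induction k)
  case (Suc k)
  then show ?case using tensor_mat_carrier[of "tensor_pow A k" "n ^ k" "m ^ k" A n m] by (simp add: mult.commute)
qed simp

lemma tensor_pow_mult_adjoint:
  assumes "A \<in> carrier_mat n m"
  shows "tensor_pow (A * mat_adjoint A) k = tensor_pow A k * mat_adjoint (tensor_pow A k)"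
proof (induction k)
  case 0
  show ?case by (rule eq_matI) auto
next
  case (Suc k)
  then show ?case using tensor_mat_mult_adjoint[OF tensor_pow_carrier[OF assms] assms] by simp
qed

lemma hs_inner_tensor_pow:
  assumes "A \<in> carrier_mat n m" "B \<in> carrier_mat n m"
  shows "hs_inner (tensor_pow A k) (tensor_pow B k) = hs_inner A B ^ k"
proof (induction k)
  case 0
  show ?case by (simp add: hs_inner_def)
next
  case (Suc k)
  then show ?case
    using hs_inner_tensor_mat[OF tensor_pow_carrier[OF assms(1)] tensor_pow_carrier[OF assms(2)] assms]
    by (simp add: mult.commute)
qed

lemma hs_sq_tensor_pow:
  assumes "A \<in> carrier_mat n m"
  shows "hs_sq (tensor_pow A k) = hs_sq A ^ k"
  using hs_inner_tensor_pow[OF assms assms, of k] unfolding hs_inner_self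
  by (simp only: of_real_power[symmetric] of_real_eq_iff)

text \<open>Bernoulli's inequality at \<open>s - 1\<close>, which is at least -1.\<close>

lemma one_minus_power_le:
  fixes s :: real
  assumes "0 \<le> s"
  shows "1 - s ^ k \<le> real k * (1 - s)"
  using Bernoulli_inequality[of "s - 1" k] assms by (simp add: algebra_simps)

text \<open>A phase in front of \<open>B\<close> makes the overlap of \<open>A\<close> and \<open>B\<close> a nonnegative number \<open>t\<close>, so that the
  overlap \<open>t\<^sup>k\<close> of the tensor powers is real as well.\<close>
lemma trace_pos_tensor_pow_le:
  assumes A: "A \<in> carrier_mat n m" "hs_sq A = 1" and B: "B \<in> carrier_mat n m" "hs_sq B = 1"
  shows "(trace_pos (tensor_pow (A * mat_adjoint A) k - tensor_pow (B * mat_adjoint B) k))\<^sup>2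
    \<le> real k * hs_sq (A - B)"
proof -
  define z where "z = hs_inner A B"
  \<comment> \<open>For \<open>z = 0\<close> any phase would do; the value 1 keeps
    \<open>cmod c = 1\<close>.\<close>
  define c where "c = (if z = 0 then 1 else z / complex_of_real (cmod z))"
  have c: "cmod c = 1" "cnj c * z = complex_of_real (cmod z)"
    by (auto simp: c_def norm_divide complex_norm_square[symmetric] mult.commute power2_eq_square)
  define B' where "B' = c \<cdot>\<^sub>m B"
  have B': "B' \<in> carrier_mat n m" using B by (simp add: B'_def)
  have hsB': "hs_sq B' = 1"
    using B c by (simp add: hs_sq_def B'_def norm_mult)
  have inner: "hs_inner A B' = complex_of_real (cmod z)"
    using A B c(2) by (simp add: hs_inner_def B'_def z_def sum_distrib_left mult_ac)
  \<comment> \<open>The phase cancels against its conjugate, so \<open>B'\<close> factorizes the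
    same state.\<close>
  have BB: "B' * mat_adjoint B' = B * mat_adjoint B"
  proof -
    have "B' * mat_adjoint B' = (c * cnj c) \<cdot>\<^sub>m (B * mat_adjoint B)"
      unfolding B'_def mat_adjoint_smult
      by (rule eq_matI) (auto simp: scalar_prod_def sum_distrib_left mult_ac intro!: sum.cong)
    also have "c * cnj c = 1" using c(1) by (simp flip: complex_norm_square)
    also have "1 \<cdot>\<^sub>m (B * mat_adjoint B) = B * mat_adjoint B" by (rule eq_matI) auto
    finally show ?thesis .
  qed
  have "(trace_pos (tensor_pow (A * mat_adjoint A) k - tensor_pow (B * mat_adjoint B) k))\<^sup>2
    \<le> 1 - (Re (hs_inner (tensor_pow A k) (tensor_pow B' k)))\<^sup>2"
    unfolding BB[symmetric] tensor_pow_mult_adjoint[OF A(1)] tensor_pow_mult_adjoint[OF B']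
    by (rule trace_distance_factorized_le[OF tensor_pow_carrier[OF A(1)] _ tensor_pow_carrier[OF B']])
       (simp_all add: hs_sq_tensor_pow[OF A(1)] hs_sq_tensor_pow[OF B'] A hsB')
  also have "\<dots> = 1 - ((cmod z)\<^sup>2) ^ k"
    unfolding hs_inner_tensor_pow[OF A(1) B'] inner by (simp add: power_mult[symmetric] mult.commute flip: of_real_power)
  also have "\<dots> \<le> real k * (1 - (cmod z)\<^sup>2)" by (rule one_minus_power_le) simp
  also have "\<dots> \<le> real k * hs_sq (A - B)"
  proof (rule mult_left_mono)
    have "1 - (cmod z)\<^sup>2 \<le> 2 * (1 - cmod z)"
      using zero_le_power2[of "1 - cmod z"] by (simp add: power2_eq_square algebra_simps)
    \<comment> \<open>Since \<open>Re z\<close> is at most \<open>cmod z\<close>, the bound can be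
      stated with the original \<open>B\<close>.\<close>
    also have "\<dots> \<le> 2 - 2 * Re z" using complex_Re_le_cmod[of z] by simp
    also have "\<dots> = hs_sq (A - B)" using hs_sq_add_diff(1)[OF A(1) B(1)] A B by (simp add: z_def)
    finally show "1 - (cmod z)\<^sup>2 \<le> hs_sq (A - B)" .
  qed simp
  finally show ?thesis .
qed

section \<open>Locally private channels\<close>

text \<open>Positivity is complete positivity with a one-dimensional ancilla, for which
  \<open>id_tensor_map\<close> returns the output itself.\<close>

lemma quantum_channel_density:
  assumes \<Phi>: "quantum_channel d dB \<Phi>" and \<rho>: "density d \<rho>"
  shows "density dB (\<Phi> \<rho>)"
proof -
  have r: "\<rho> \<in> carrier_mat d d" using \<rho> by (auto simp: density_def psd_def)
  have "\<Phi> \<rho> \<in> carrier_mat dB dB" using \<Phi> r by (auto simp: quantum_channel_def)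
  moreover have "mat d d (\<lambda>(i, j). \<rho> $$ (i, j)) = \<rho>" using r by (intro eq_matI) auto
  ultimately have "id_tensor_map 1 d dB \<Phi> \<rho> = \<Phi> \<rho>"
    by (intro eq_matI) (auto simp: id_tensor_map_def)
  then have "psd dB (\<Phi> \<rho>)"
    using \<Phi> \<rho> unfolding quantum_channel_def density_def by (metis mult_1)
  moreover have "mtrace (\<Phi> \<rho>) = 1"
    using \<Phi> \<rho> r by (auto simp: quantum_channel_def density_def)
  ultimately show ?thesis by (simp add: density_def)
qed

text \<open>The privacy condition as an operator inequality: the vanishing divergence leaves no
  positive eigenvalue in the difference with the scaled output.\<close>

lemma LDP_qform_le:
  assumes \<Phi>: "LDP \<epsilon> d dB \<Phi>" and \<rho>: "density d \<rho>" and \<sigma>: "density d \<sigma>" and v: "v \<in> carrier_vec dB"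
  shows "qform (\<Phi> \<rho>) v \<le> exp \<epsilon> * qform (\<Phi> \<sigma>) v"
proof -
  have ch: "quantum_channel d dB \<Phi>" using \<Phi> by (simp add: LDP_def)
  have r: "\<Phi> \<rho> \<in> carrier_mat dB dB" "mat_adjoint (\<Phi> \<rho>) = \<Phi> \<rho>"
    and s: "\<Phi> \<sigma> \<in> carrier_mat dB dB" "mat_adjoint (\<Phi> \<sigma>) = \<Phi> \<sigma>"
    using quantum_channel_density[OF ch \<rho>] quantum_channel_density[OF ch \<sigma>] by (auto simp: density_def psd_def)
  have "qform (\<Phi> \<rho> - complex_of_real (exp \<epsilon>) \<cdot>\<^sub>m \<Phi> \<sigma>) v \<le> 0"
  proof (rule trace_pos_eq_0_imp_qform_le_0[OF _ _ _ v])
    show "mat_adjoint (\<Phi> \<rho> - complex_of_real (exp \<epsilon>) \<cdot>\<^sub>m \<Phi> \<sigma>) = \<Phi> \<rho> - complex_of_real (exp \<epsilon>) \<cdot>\<^sub>m \<Phi> \<sigma>"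
      using r s by (subst mat_adjoint_diff[of _ dB dB]) (auto simp: mat_adjoint_smult)
    show "trace_pos (\<Phi> \<rho> - complex_of_real (exp \<epsilon>) \<cdot>\<^sub>m \<Phi> \<sigma>) = 0"
      using \<Phi> \<rho> \<sigma> by (auto simp: LDP_def E_gamma_def)
  qed (use r s in auto)
  then show ?thesis using r s v by (simp add: qform_diff[of _ dB] qform_smult[of _ dB])
qed

lemma density_unitary_diag:
  assumes U: "U \<in> carrier_mat n n" "mat_adjoint U * U = 1\<^sub>m n" "U * mat_adjoint U = 1\<^sub>m n"
    and p: "\<And>i. i < n \<Longrightarrow> 0 \<le> p i" "(\<Sum>i<n. p i) = 1"
  shows "density n (U * diag_of n p * mat_adjoint U)"
proof -
  note U' = mat_adjoint_carrier[OF U(1)]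
  have "psd n (U * diag_of n p * mat_adjoint U)"
    unfolding psd_iff_qform
  proof (intro conjI ballI)
    show "U * diag_of n p * mat_adjoint U \<in> carrier_mat n n"
      using U(1) U' by (simp add: mult_carrier_mat[of _ n n _ n])
    show "mat_adjoint (U * diag_of n p * mat_adjoint U) = U * diag_of n p * mat_adjoint U"
      using hermitian_congruence[OF U' diag_of_carrier mat_adjoint_diag_of] by simp
    show "0 \<le> qform (U * diag_of n p * mat_adjoint U) v" if "v \<in> carrier_vec n" for v
      using qform_unitary_diag_ge[OF U(1,3), of 0 p v] p(1) that by simp
  qed
  moreover have "mtrace (U * diag_of n p * mat_adjoint U) = 1"
    using mtrace_unitary_conj[of "mat_adjoint U" n "diag_of n p"] U U' p(2) by (simp add: mtrace_diag_of flip: of_real_sum)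
  ultimately show ?thesis by (simp add: density_def)
qed

text \<open>The Jordan decomposition \<open>\<rho> - \<sigma> = E (\<tau>\<^sub>1 - \<tau>\<^sub>2)\<close> with \<open>E\<close> the trace distance, rearranged so that
  no subtraction occurs (linearity of channels is stated for sums).\<close>
lemma trace_distance_decomposition:
  assumes \<rho>: "density n \<rho>" and \<sigma>: "density n \<sigma>"
  obtains \<tau>\<^sub>1 \<tau>\<^sub>2 where "density n \<tau>\<^sub>1" "density n \<tau>\<^sub>2"
    "complex_of_real (E_gamma 1 \<rho> \<sigma>) \<cdot>\<^sub>m \<tau>\<^sub>1 + \<sigma> = complex_of_real (E_gamma 1 \<rho> \<sigma>) \<cdot>\<^sub>m \<tau>\<^sub>2 + \<rho>"
    "E_gamma 1 \<rho> \<sigma> \<ge> 0"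
proof -
  have r: "\<rho> \<in> carrier_mat n n" "mat_adjoint \<rho> = \<rho>" "mtrace \<rho> = 1"
    and s: "\<sigma> \<in> carrier_mat n n" "mat_adjoint \<sigma> = \<sigma>" "mtrace \<sigma> = 1"
    using \<rho> \<sigma> by (auto simp: density_def psd_def)
  define E where "E = E_gamma 1 \<rho> \<sigma>"
  have E: "E = trace_pos (\<rho> - \<sigma>)"
  proof -
    have "complex_of_real 1 \<cdot>\<^sub>m \<sigma> = \<sigma>" by (rule eq_matI) auto
    then show ?thesis by (simp add: E_def E_gamma_def)
  qed
  have D: "\<rho> - \<sigma> \<in> carrier_mat n n" "mat_adjoint (\<rho> - \<sigma>) = \<rho> - \<sigma>"
    using r s by (auto simp: mat_adjoint_diff[of _ n n])
  obtain U l where U: "U \<in> carrier_mat n n" "mat_adjoint U * U = 1\<^sub>m n" "U * mat_adjoint U = 1\<^sub>m n"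
    and l: "mat_adjoint U * (\<rho> - \<sigma>) * U = diag_of n l" "\<rho> - \<sigma> = U * diag_of n l * mat_adjoint U"
    using unitary_decomposition[OF D] by blast
  note U' = mat_adjoint_carrier[OF U(1)]
  have El: "E = (\<Sum>i<n. max 0 (l i))" unfolding E by (rule trace_pos_eigenvalues[OF D(1) U l(2)])
  have "complex_of_real (\<Sum>i<n. l i) = 0"
    using mtrace_unitary_conj[OF U(1,3) D(1)] l(1) mtrace_diff[OF r(1) s(1)] r s by (simp add: mtrace_diag_of)
  then have l0: "(\<Sum>i<n. l i) = 0" by (simp only: of_real_eq_0_iff)
  \<comment> \<open>The eigenvalues sum to 0, so the negative part weighs as much as the positive
    part.\<close>
  have "max 0 (l i) - max 0 (- l i) = l i" for i by (auto simp: max_def)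
  then have "(\<Sum>i<n. max 0 (l i)) - (\<Sum>i<n. max 0 (- l i)) = 0"
    using l0 by (simp add: sum_subtractf[symmetric])
  then have El': "E = (\<Sum>i<n. max 0 (- l i))" using El by simp
  have E0: "E \<ge> 0" unfolding El by (intro sum_nonneg) auto
  show ?thesis
  \<comment> \<open>If \<open>E = 0\<close> the parts cannot be normalized; the states then coincide
    and \<open>\<rho>\<close> serves as both parts.\<close>
  proof (cases "E = 0")
    case True
    have "l i = 0" if "i < n" for i
    proof -
      have "max 0 (l i) = 0" "max 0 (- l i) = 0"
        using True El El' that by (auto simp: sum_nonneg_eq_0_iff)
      then show ?thesis by (auto simp: max_def split: if_splits)
    qed
    then have "diag_of n l = 0\<^sub>m n n" by (intro eq_matI) auto
    then have "\<rho> - \<sigma> = 0\<^sub>m n n" using l(2) U(1) U' by simp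
    then have "(\<rho> - \<sigma>) $$ (i, j) = 0" if "i < n" "j < n" for i j using that by simp
    then have "\<rho> = \<sigma>" using r s by (intro eq_matI) auto
    then show ?thesis using that[OF \<rho> \<rho>] E0 by (simp add: E_def)
  next
    case False
    then have pos: "E > 0" using E0 by simp
    define \<tau> where "\<tau> f = U * diag_of n (\<lambda>i. f i / E) * mat_adjoint U" for f
    have c\<tau>: "\<tau> f \<in> carrier_mat n n" for f using U(1) U' by (simp add: \<tau>_def mult_carrier_mat[of _ n n _ n])
    have den: "density n (\<tau> f)" if "\<And>i. 0 \<le> f i" "(\<Sum>i<n. f i) = E" for f
      unfolding \<tau>_def using that pos by (intro density_unitary_diag[OF U]) (auto simp flip: sum_divide_distrib)
    have E\<tau>: "complex_of_real E \<cdot>\<^sub>m \<tau> f = U * diag_of n f * mat_adjoint U" for f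
    proof -
      have "complex_of_real E \<cdot>\<^sub>m \<tau> f = U * (complex_of_real E \<cdot>\<^sub>m diag_of n (\<lambda>i. f i / E)) * mat_adjoint U"
        unfolding \<tau>_def mult_smult_distrib[OF U(1) diag_of_carrier]
          mult_smult_assoc_mat[OF mult_carrier_mat[OF U(1) diag_of_carrier] U'] ..
      also have "complex_of_real E \<cdot>\<^sub>m diag_of n (\<lambda>i. f i / E) = diag_of n f"
        by (rule eq_matI) (use pos in auto)
      finally show ?thesis .
    qed
    have "diag_of n l + diag_of n (\<lambda>i. max 0 (- l i)) = diag_of n (\<lambda>i. max 0 (l i))"
      by (rule eq_matI) (auto simp: max_def simp flip: of_real_add)
    then have "U * diag_of n (\<lambda>i. max 0 (l i)) * mat_adjoint U = \<rho> - \<sigma> + complex_of_real E \<cdot>\<^sub>m \<tau> (\<lambda>i. max 0 (- l i))"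
      unfolding E\<tau> l(2) using U(1) U'
      by (simp add: mult_minus_add_distrib_mat(2)[OF diag_of_carrier diag_of_carrier U(1), symmetric]
          add_mult_distrib_mat[OF mult_carrier_mat[OF U(1) diag_of_carrier] mult_carrier_mat[OF U(1) diag_of_carrier] U', symmetric])
    then have eq: "complex_of_real E \<cdot>\<^sub>m \<tau> (\<lambda>i. max 0 (l i)) = \<rho> - \<sigma> + complex_of_real E \<cdot>\<^sub>m \<tau> (\<lambda>i. max 0 (- l i))"
      unfolding E\<tau> .
    have "complex_of_real E \<cdot>\<^sub>m \<tau> (\<lambda>i. max 0 (l i)) + \<sigma> = complex_of_real E \<cdot>\<^sub>m \<tau> (\<lambda>i. max 0 (- l i)) + \<rho>"
      unfolding eq by (rule eq_matI) (use r s c\<tau>[of "\<lambda>i. max 0 (- l i)"] in auto)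
    then show ?thesis
      using that[OF den[of "\<lambda>i. max 0 (l i)"] den[of "\<lambda>i. max 0 (- l i)"]] El El' E0 by (simp add: E_def)
  qed
qed

text \<open>The reference state is (up to a factor) the average of the images of the two parts of the
  Jordan decomposition; it lies below both outputs and it dominates their difference.\<close>
lemma LDP_close_factorizations:
  assumes \<epsilon>: "\<epsilon> > 0" and \<Phi>: "LDP \<epsilon> d dB \<Phi>" and \<rho>: "density d \<rho>" and \<sigma>: "density d \<sigma>"
  obtains A B where "A \<in> carrier_mat dB dB" "B \<in> carrier_mat dB dB"
    "A * mat_adjoint A = \<Phi> \<rho>" "B * mat_adjoint B = \<Phi> \<sigma>"
    "hs_sq (A - B) \<le> exp (- \<epsilon>) * (exp \<epsilon> - 1)\<^sup>2 * (E_gamma 1 \<rho> \<sigma>)\<^sup>2"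
proof -
  define E where "E = E_gamma 1 \<rho> \<sigma>"
  obtain \<tau>1 \<tau>2 where \<tau>: "density d \<tau>1" "density d \<tau>2"
    and dec: "complex_of_real E \<cdot>\<^sub>m \<tau>1 + \<sigma> = complex_of_real E \<cdot>\<^sub>m \<tau>2 + \<rho>" and E0: "E \<ge> 0"
    using trace_distance_decomposition[OF \<rho> \<sigma>] unfolding E_def by metis
  have ch: "quantum_channel d dB \<Phi>" using \<Phi> by (simp add: LDP_def)
  have lin: "\<Phi> (a \<cdot>\<^sub>m X + Y) = a \<cdot>\<^sub>m \<Phi> X + \<Phi> Y" if "X \<in> carrier_mat d d" "Y \<in> carrier_mat d d" for a X Y
    using ch that by (auto simp: quantum_channel_def)
  have in_car: "X \<in> carrier_mat d d" if "density d X" for X using that by (auto simp: density_def psd_def)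
  have psd: "psd dB (\<Phi> X)" and tr: "mtrace (\<Phi> X) = 1" and car: "\<Phi> X \<in> carrier_mat dB dB"
    and herm: "mat_adjoint (\<Phi> X) = \<Phi> X" if "density d X" for X
    using quantum_channel_density[OF ch that] by (auto simp: density_def psd_def)
  have pos: "0 \<le> qform (\<Phi> X) v" if "density d X" "v \<in> carrier_vec dB" for X v
    using psd[OF that(1)] that(2) by (auto simp: psd_iff_qform)
  have le: "qform (\<Phi> X) v \<le> exp \<epsilon> * qform (\<Phi> Y) v" if "density d X" "density d Y" "v \<in> carrier_vec dB" for X Y v
    by (rule LDP_qform_le[OF \<Phi> that])
  define T where "T = \<Phi> \<tau>1 + \<Phi> \<tau>2"
  have T: "T \<in> carrier_mat dB dB" "mat_adjoint T = T"
    using car[OF \<tau>(1)] car[OF \<tau>(2)] herm[OF \<tau>(1)] herm[OF \<tau>(2)] by (auto simp: T_def mat_adjoint_add[of _ dB dB])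
  \<comment> \<open>The average of the two images is at most \<open>exp \<epsilon>\<close> times any
    output, so scaling it by \<open>exp (- \<epsilon>)\<close> puts it below every output.\<close>
  define \<omega> where "\<omega> = complex_of_real (exp (- \<epsilon>) / 2) \<cdot>\<^sub>m T"
  have \<omega>: "\<omega> \<in> carrier_mat dB dB" using T by (simp add: \<omega>_def)
  have q\<omega>: "qform \<omega> v = exp (- \<epsilon>) / 2 * (qform (\<Phi> \<tau>1) v + qform (\<Phi> \<tau>2) v)" if v: "v \<in> carrier_vec dB" for v
  proof -
    have "qform \<omega> v = exp (- \<epsilon>) / 2 * qform T v" unfolding \<omega>_def by (rule qform_smult[OF T(1) v])
    also have "qform T v = qform (\<Phi> \<tau>1) v + qform (\<Phi> \<tau>2) v"
      unfolding T_def by (rule qform_add[OF car[OF \<tau>(1)] car[OF \<tau>(2)] v])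
    finally show ?thesis .
  qed
  have psd\<omega>: "psd dB \<omega>"
    unfolding psd_iff_qform
  proof (intro conjI ballI)
    show "mat_adjoint \<omega> = \<omega>" by (simp add: \<omega>_def mat_adjoint_smult T)
    show "0 \<le> qform \<omega> v" if "v \<in> carrier_vec dB" for v
      unfolding q\<omega>[OF that] using pos[OF \<tau>(1) that] pos[OF \<tau>(2) that] by simp
  qed (rule \<omega>)
  have tr\<omega>: "mtrace \<omega> = complex_of_real (exp (- \<epsilon>))"
  proof -
    have "mtrace T = 2"
      using tr[OF \<tau>(1)] tr[OF \<tau>(2)] car[OF \<tau>(1)] car[OF \<tau>(2)] by (auto simp: T_def mtrace_def sum.distrib)
    moreover have "mtrace \<omega> = complex_of_real (exp (- \<epsilon>) / 2) * mtrace T"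
      using T unfolding mtrace_def \<omega>_def sum_distrib_left by (intro sum.cong) auto
    ultimately show ?thesis by simp
  qed
  have x: "exp \<epsilon> > 1" "exp (- \<epsilon>) = 1 / exp \<epsilon>" using \<epsilon> by (auto simp: exp_minus field_simps)
  have lower: "qform \<omega> v \<le> qform (\<Phi> X) v" and upper: "qform (\<Phi> X) v \<le> (exp \<epsilon>)\<^sup>2 * qform \<omega> v"
    if X: "density d X" and v: "v \<in> carrier_vec dB" for X v
  proof -
    have "qform (\<Phi> \<tau>1) v + qform (\<Phi> \<tau>2) v \<le> 2 * exp \<epsilon> * qform (\<Phi> X) v"
      using le[OF \<tau>(1) X v] le[OF \<tau>(2) X v] by simp
    then show "qform \<omega> v \<le> qform (\<Phi> X) v"
      unfolding q\<omega>[OF v] x(2) using x(1) by (simp add: field_simps)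
    \<comment> \<open>This bound serves to confine the outputs to the support of
      \<open>\<omega>\<close>. Averaging two privacy inequalities costs one factor
      \<open>exp \<epsilon>\<close>, undoing the scaling of \<open>\<omega>\<close> the
      other.\<close>
    have "2 * qform (\<Phi> X) v \<le> exp \<epsilon> * (qform (\<Phi> \<tau>1) v + qform (\<Phi> \<tau>2) v)"
      using le[OF X \<tau>(1) v] le[OF X \<tau>(2) v] by (simp add: algebra_simps)
    also have "\<dots> = 2 * ((exp \<epsilon>)\<^sup>2 * qform \<omega> v)"
      unfolding q\<omega>[OF v] x(2) using x(1) by (simp add: power2_eq_square)
    finally show "qform (\<Phi> X) v \<le> (exp \<epsilon>)\<^sup>2 * qform \<omega> v" by simp
  qed
  have diff: "\<bar>qform (\<Phi> \<rho>) v - qform (\<Phi> \<sigma>) v\<bar> \<le> (2 * E * (exp \<epsilon> - 1)) * qform \<omega> v" if v: "v \<in> carrier_vec dB" for v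
  proof -
    let ?a = "qform (\<Phi> \<tau>1) v" and ?b = "qform (\<Phi> \<tau>2) v"
    have "\<Phi> (complex_of_real E \<cdot>\<^sub>m \<tau>1 + \<sigma>) = \<Phi> (complex_of_real E \<cdot>\<^sub>m \<tau>2 + \<rho>)" by (simp only: dec)
    then have "complex_of_real E \<cdot>\<^sub>m \<Phi> \<tau>1 + \<Phi> \<sigma> = complex_of_real E \<cdot>\<^sub>m \<Phi> \<tau>2 + \<Phi> \<rho>"
      by (simp only: lin in_car \<tau> \<rho> \<sigma>)
    then have "qform (complex_of_real E \<cdot>\<^sub>m \<Phi> \<tau>1 + \<Phi> \<sigma>) v = qform (complex_of_real E \<cdot>\<^sub>m \<Phi> \<tau>2 + \<Phi> \<rho>) v"
      by simp
    then have "E * ?a + qform (\<Phi> \<sigma>) v = E * ?b + qform (\<Phi> \<rho>) v"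
      using car[OF \<tau>(1)] car[OF \<tau>(2)] car[OF \<rho>] car[OF \<sigma>] v by (simp add: qform_add[of _ dB] qform_smult[of _ dB])
    then have "qform (\<Phi> \<rho>) v - qform (\<Phi> \<sigma>) v = E * (?a - ?b)" by (simp add: algebra_simps)
    then have "\<bar>qform (\<Phi> \<rho>) v - qform (\<Phi> \<sigma>) v\<bar> = E * \<bar>?a - ?b\<bar>" using E0 by (simp add: abs_mult)
    also have "\<bar>?a - ?b\<bar> \<le> (exp \<epsilon> - 1) * (exp (- \<epsilon>) * (?a + ?b))"
    proof -
      \<comment> \<open>The last two inequalities compare an image with itself. Adding the first and
        the fourth gives \<open>?a + ?b \<le> 2 * exp \<epsilon> * ?b\<close>, a rearrangement of
        the first bound derived next; the other bound is symmetric.\<close>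
      have "?a \<le> exp \<epsilon> * ?b" "?b \<le> exp \<epsilon> * ?a" "?a \<le> exp \<epsilon> * ?a" "?b \<le> exp \<epsilon> * ?b"
        using le \<tau> v by auto
      then have "exp \<epsilon> * (?a - ?b) \<le> (exp \<epsilon> - 1) * (?a + ?b)" "exp \<epsilon> * (?b - ?a) \<le> (exp \<epsilon> - 1) * (?a + ?b)"
        by (simp_all add: algebra_simps)
      then have "exp \<epsilon> * \<bar>?a - ?b\<bar> \<le> (exp \<epsilon> - 1) * (?a + ?b)" by (simp add: abs_if)
      then show ?thesis unfolding x(2) using x(1) by (simp add: field_simps)
    qed
    also have "E * ((exp \<epsilon> - 1) * (exp (- \<epsilon>) * (?a + ?b))) = (2 * E * (exp \<epsilon> - 1)) * qform \<omega> v"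
      unfolding q\<omega>[OF v] by simp
    finally show ?thesis using E0 by (simp add: mult_left_mono)
  qed
  have "2 * E * (exp \<epsilon> - 1) \<ge> 0" using E0 x by simp
  from close_factorizations[OF psd\<omega> psd[OF \<rho>] psd[OF \<sigma>] lower[OF \<rho>] upper[OF \<rho>] lower[OF \<sigma>] upper[OF \<sigma>] diff this]
  obtain A B where AB: "A \<in> carrier_mat dB dB" "B \<in> carrier_mat dB dB"
    "A * mat_adjoint A = \<Phi> \<rho>" "B * mat_adjoint B = \<Phi> \<sigma>"
    and hs: "hs_sq (A - B) \<le> ((2 * E * (exp \<epsilon> - 1)) / 2)\<^sup>2 * Re (mtrace \<omega>)" by blast
  \<comment> \<open>The factor 2 in \<open>diff\<close> cancels against the Lipschitz constant 1/2,
    and the trace of \<open>\<omega>\<close> supplies \<open>exp (- \<epsilon>)\<close>.\<close>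
  have "((2 * E * (exp \<epsilon> - 1)) / 2)\<^sup>2 * Re (mtrace \<omega>) = exp (- \<epsilon>) * (exp \<epsilon> - 1)\<^sup>2 * (E_gamma 1 \<rho> \<sigma>)\<^sup>2"
    unfolding tr\<omega> by (simp add: E_def power_mult_distrib)
  then show ?thesis using that[OF AB] hs by simp
qed

section \<open>From factorizations to sample complexity\<close>

lemma LDP_trace_distance_power_le:
  assumes \<epsilon>: "\<epsilon> > 0" and \<Phi>: "LDP \<epsilon> d dB \<Phi>" and \<rho>: "density d \<rho>" and \<sigma>: "density d \<sigma>"
  shows "(E_gamma 1 (tensor_pow (\<Phi> \<rho>) k) (tensor_pow (\<Phi> \<sigma>) k))\<^sup>2
    \<le> real k * (exp (- \<epsilon>) * (exp \<epsilon> - 1)\<^sup>2 * (E_gamma 1 \<rho> \<sigma>)\<^sup>2)"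
proof -
  have ch: "quantum_channel d dB \<Phi>" using \<Phi> by (simp add: LDP_def)
  obtain A B where AB: "A \<in> carrier_mat dB dB" "B \<in> carrier_mat dB dB"
    "A * mat_adjoint A = \<Phi> \<rho>" "B * mat_adjoint B = \<Phi> \<sigma>"
    and hs: "hs_sq (A - B) \<le> exp (- \<epsilon>) * (exp \<epsilon> - 1)\<^sup>2 * (E_gamma 1 \<rho> \<sigma>)\<^sup>2"
    using LDP_close_factorizations[OF assms] by blast
  \<comment> \<open>The outputs have trace 1, so both factors have unit Hilbert-Schmidt norm, as the
    tensor-power bound requires.\<close>
  have "complex_of_real (hs_sq A) = 1" "complex_of_real (hs_sq B) = 1"
    using mtrace_mult_adjoint[of A] mtrace_mult_adjoint[of B] AB(3,4)
      quantum_channel_density[OF ch \<rho>] quantum_channel_density[OF ch \<sigma>] by (simp_all add: density_def)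
  then have one: "hs_sq A = 1" "hs_sq B = 1" by simp_all
  have "complex_of_real 1 \<cdot>\<^sub>m X = X" for X :: "complex mat" by (rule eq_matI) auto
  then have "E_gamma 1 (tensor_pow (\<Phi> \<rho>) k) (tensor_pow (\<Phi> \<sigma>) k)
    = trace_pos (tensor_pow (A * mat_adjoint A) k - tensor_pow (B * mat_adjoint B) k)"
    by (simp add: E_gamma_def AB)
  then have "(E_gamma 1 (tensor_pow (\<Phi> \<rho>) k) (tensor_pow (\<Phi> \<sigma>) k))\<^sup>2 \<le> real k * hs_sq (A - B)"
    using trace_pos_tensor_pow_le[OF AB(1) one(1) AB(2) one(2), of k] by simp
  also have "\<dots> \<le> real k * (exp (- \<epsilon>) * (exp \<epsilon> - 1)\<^sup>2 * (E_gamma 1 \<rho> \<sigma>)\<^sup>2)"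
    using hs by (intro mult_left_mono) auto
  finally show ?thesis .
qed

text \<open>At \<open>p = 1/2\<close> the index \<open>(1 - p) / p\<close> is 1 and the error is
  half of one minus the trace distance. An error of at most \<open>\<delta>\<close> thus forces a
  trace distance of at least \<open>1 - 2 * \<delta>\<close> on \<open>n\<close> copies, while
  privacy bounds its square linearly in \<open>n\<close>.\<close>

lemma n_B_eps_ge:
  assumes \<epsilon>: "\<epsilon> > 0" and \<delta>: "\<delta> < 1/2" and \<rho>: "density d \<rho>" and \<sigma>: "density d \<sigma>"
  shows "n_B_eps \<epsilon> d \<rho> \<sigma> (1/2) \<delta> \<ge>
    ediv ((1 - 2 * \<delta>)^2) (exp (- \<epsilon>) * (exp \<epsilon> - 1)^2 * (E_gamma 1 \<rho> \<sigma>)^2)"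
proof -
  let ?K = "exp (- \<epsilon>) * (exp \<epsilon> - 1)^2 * (E_gamma 1 \<rho> \<sigma>)^2"
  have K: "?K \<ge> 0" by simp
  have bound: "ediv ((1 - 2 * \<delta>)^2) ?K \<le> ereal (real n)"
    if \<Phi>: "LDP \<epsilon> d dB \<Phi>" and perr: "p_err (tensor_pow (\<Phi> \<rho>) n) (tensor_pow (\<Phi> \<sigma>) n) (1/2) \<le> \<delta>" for dB \<Phi> n
  proof -
    let ?E = "E_gamma 1 (tensor_pow (\<Phi> \<rho>) n) (tensor_pow (\<Phi> \<sigma>) n)"
    have "1 - 2 * \<delta> \<le> ?E" using perr by (simp add: p_err_def)
    then have "(1 - 2 * \<delta>)\<^sup>2 \<le> ?E\<^sup>2" using \<delta> by (intro power_mono) auto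
    also have "\<dots> \<le> real n * ?K" by (rule LDP_trace_distance_power_le[OF \<epsilon> \<Phi> \<rho> \<sigma>])
    finally have le: "(1 - 2 * \<delta>)\<^sup>2 \<le> real n * ?K" .
    moreover have "(1 - 2 * \<delta>)\<^sup>2 > 0" using \<delta> by simp
    \<comment> \<open>If \<open>?K = 0\<close>, no \<open>n\<close> can reach the error
      \<open>\<delta>\<close>, in agreement with the value infinity of \<open>ediv\<close>.\<close>
    ultimately have "?K \<noteq> 0" by (intro notI) (simp only: mult_zero_right)
    then have "?K > 0" using K by linarith
    then show ?thesis using le \<open>?K \<noteq> 0\<close> by (simp only: ediv_def if_False ereal_less_eq pos_divide_le_eq)
  qed
  show ?thesis
    unfolding n_B_eps_def
  proof (rule INF_greatest, clarify)
    fix dB \<Phi> assume "LDP \<epsilon> d dB \<Phi>"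
    then show "ediv ((1 - 2 * \<delta>)^2) ?K \<le> n_B (\<Phi> \<rho>) (\<Phi> \<sigma>) (1/2) \<delta>"
      unfolding n_B_def using bound by (intro Inf_greatest) blast
  qed
qed

theorem mainTheorem4:
  fixes d :: nat and \<rho> \<sigma> :: "complex mat" and \<epsilon> \<delta> :: real
  assumes "\<epsilon> > 0" and "0 < \<delta>" and "\<delta> < 1/2"
    and "density d \<rho>" and "density d \<sigma>"
  shows "n_B_eps \<epsilon> d \<rho> \<sigma> (1/2) \<delta> \<ge>
           ediv ((1 - 2 * \<delta>)^2) (exp (- \<epsilon>) * (exp \<epsilon> - 1)^2 * (E_gamma 1 \<rho> \<sigma>)^2)
       \<and> n_B_eps \<epsilon> d \<rho> \<sigma> (1/2) (1/10) \<ge>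
           ereal (16/25) * ediv 1 (exp (- \<epsilon>) * (exp \<epsilon> - 1)^2 * (E_gamma 1 \<rho> \<sigma>)^2)"
proof
  show "n_B_eps \<epsilon> d \<rho> \<sigma> (1/2) \<delta> \<ge>
           ediv ((1 - 2 * \<delta>)^2) (exp (- \<epsilon>) * (exp \<epsilon> - 1)^2 * (E_gamma 1 \<rho> \<sigma>)^2)"
    by (rule n_B_eps_ge) (use assms in auto)
  \<comment> \<open>Here \<open>1 - 2/10\<close> is \<open>4/5\<close>, with square
    \<open>16/25\<close>; for \<open>b = 0\<close> both sides are infinite.\<close>
  have "ereal (16/25) * ediv 1 b = ediv ((1 - 2 * (1/10))^2) b" for b
    by (simp add: ediv_def power2_eq_square)
  then show "n_B_eps \<epsilon> d \<rho> \<sigma> (1/2) (1/10) \<ge>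
           ereal (16/25) * ediv 1 (exp (- \<epsilon>) * (exp \<epsilon> - 1)^2 * (E_gamma 1 \<rho> \<sigma>)^2)"
    using n_B_eps_ge[OF assms(1) _ assms(4,5), of "1/10"] by simp
qed

end
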